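(* For $n\geq 5$, \[ a_n(\sigma;312) = \begin{cases} \lceil n/2\rceil + 1 & \text{if } \sigma=123,\\ n-1 & \text{if } \sigma=132,\\ F_n & \text{if } \sigma=213,\\ 1 & \text{if } \sigma=231,\\ \displaystyle\sum_{k=0}^{\lfloor (n-1)/3\rfloor}\binom{n-1-k}{2k} & \text{if } \sigma=312,\\ 2^{n-2} & \text{if } \sigma=321,\end{cases} \] where $F_n$ is the $n$-th Fibonacci number.
   Context: Fibonacci numbers: $F_1=F_2=1$, $F_n=F_{n-1}+F_{n-2}$. $\mathcal{S}_n$ is the set of permutations of $[n]=\{1,\dots,n\}$, written in one-line notation $\pi=\pi_1\pi_2\cdots\pi_n$ with $\pi_i=\pi(i)$. A permutation is cyclic if it consists of exactly one $n$-cycle. For a cyclic $\pi$, its standard cycle notation is $C(\pi)=(c_1,c_2,\dots,c_n)$ with $c_1=1$ and $c_i=\pi_{c_{i-1}}$ for $2\le i\le n$. A sequence of distinct integers $w_1\cdots w_m$ contains a pattern $\sigma\in\mathcal{S}_k$ if there are indices $i_1<\dots<i_k$ with $w_{i_1}\cdots w_{i_k}$ in the same relative order as $\sigma_1\cdots\sigma_k$; otherwise it avoids $\sigma$. For $\sigma,\tau\in\mathcal{S}_3$, $\mathcal{A}_n(\sigma;\tau)$ is the set of cyclic permutations $\pi\in\mathcal{S}_n$ whose one-line notation avoids $\sigma$ and whose cycle notation $C(\pi)$ (as the sequence $c_1c_2\cdots c_n$) avoids $\tau$; $a_n(\sigma;\tau)=|\mathcal{A}_n(\sigma;\tau)|$.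 *)

theory Defs
  imports Complex_Main "HOL-Combinatorics.Combinatorics" "HOL-Number_Theory.Fib"
begin

text \<open>
  Elements of \<open>S\<^sub>n\<close> are functions \<open>\<pi> :: nat \<Rightarrow> nat\<close> with \<open>\<pi> permutes {1..n}\<close>.  Such a function is
  the identity outside \<open>{1..n}\<close>, so each permutation has a unique representative.  Words and
  patterns are lists, whose positions are counted from 0.
\<close>

definition contains_pattern :: "nat list \<Rightarrow> nat list \<Rightarrow> bool" where
  "contains_pattern w \<sigma> \<longleftrightarrow>
     (\<exists>f :: nat \<Rightarrow> nat. strict_mono_on {..<length \<sigma>} f \<and> f ` {..<length \<sigma>} \<subseteq> {..<length w} \<and>
        (\<forall>a<length \<sigma>. \<forall>b<length \<sigma>. w ! f a < w ! f b \<longleftrightarrow> \<sigma> ! a < \<sigma> ! b))"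

abbreviation avoids_pattern :: "nat list \<Rightarrow> nat list \<Rightarrow> bool" where
  "avoids_pattern w \<sigma> \<equiv> \<not> contains_pattern w \<sigma>"

definition one_line :: "nat \<Rightarrow> (nat \<Rightarrow> nat) \<Rightarrow> nat list" where
  "one_line n \<pi> = map \<pi> [1..<Suc n]"

text \<open>
  The entry at list position \<open>i\<close> is \<open>c\<^sub>i\<^sub>+\<^sub>1 = \<pi>\<^sup>i(1)\<close>.  This is the cycle notation \<open>C(\<pi>)\<close> only
  when \<open>\<pi>\<close> is cyclic.
\<close>

definition cycle_notation :: "nat \<Rightarrow> (nat \<Rightarrow> nat) \<Rightarrow> nat list" where
  "cycle_notation n \<pi> = map (\<lambda>i. (\<pi> ^^ i) 1) [0..<n]"

definition cyclic_avoiders :: "nat \<Rightarrow> nat list \<Rightarrow> nat list \<Rightarrow> (nat \<Rightarrow> nat) set" where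
  "cyclic_avoiders n \<sigma> \<tau> =
     {\<pi>. \<pi> permutes {1..n} \<and> cyclic_on \<pi> {1..n} \<and>
         avoids_pattern (one_line n \<pi>) \<sigma> \<and> avoids_pattern (cycle_notation n \<pi>) \<tau>}"

definition num_cyclic_avoiders :: "nat \<Rightarrow> nat list \<Rightarrow> nat list \<Rightarrow> nat" where
  "num_cyclic_avoiders n \<sigma> \<tau> = card (cyclic_avoiders n \<sigma> \<tau>)"

end

theory Submission
  imports Defs "HOL-Library.Sublist"
begin

text \<open>
  A cyclic permutation is its cycle notation, a word on \<open>{1..n}\<close> starting with 1, and its one-line notation is
  the set of edges \<open>(x, \<pi>(x))\<close> of the closed path through that word.  For each \<open>\<sigma>\<close> one shows that
  an admissible word, up to few exceptions, has a prescribed beginning or end: it starts with \<open>1, 2\<close>, or it ends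
  with \<open>2\<close>, with \<open>2, n\<close> or with \<open>n - 1, n\<close>.  Removing these entries acts on the remaining edges by increasing
  relabellings of sources and targets, so it preserves pattern avoidance and yields a recursion.  For
  \<open>\<sigma> = 312\<close> the entries removed at the beginning form a block that is determined by its length, which gives
  \<open>a\<^sub>n = a\<^sub>n\<^sub>-\<^sub>1 + a\<^sub>1 + \<dots> + a\<^sub>n\<^sub>-\<^sub>3\<close>.
\<close>

text \<open>The entry 2 controls the cycle. If \<open>x > 2\<close> stands before 2 and
  \<open>z\<close> after it, then \<open>x, 2, z\<close> is a 312 unless \<open>x < z\<close>. So
  small labels come before 2 and larger ones after it, and what \<sigma> still has to settle are
  mainly the neighbours of 2 and the last entry. The obstacle in deleting entries is the closing
  edge, which does not follow the relabelling of the entries: its target 1 either moves although the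
  entry 1 stays, or stays although the entry 1 moves. Sources and targets are thus relabelled by
  different maps. This is why the condition for \<sigma> is put on a set of edges ordered by source:
  two different increasing maps preserve it, and each deleted edge can be discussed through its
  extreme source or target.\<close>

fun steps :: "'a list \<Rightarrow> ('a \<times> 'a) set" where
  "steps (x # y # zs) = insert (x, y) (steps (y # zs))"
| "steps _ = {}"

definition cyc :: "'a list \<Rightarrow> ('a \<times> 'a) set" where
  "cyc c = insert (last c, hd c) (steps c)"

definition words :: "nat \<Rightarrow> nat list set" where
  "words n = {c. distinct c \<and> set c = {1..n} \<and> c \<noteq> [] \<and> hd c = 1}"

text \<open>Phrased over entries instead of positions, because entries are easier to follow through
  concatenation and relabelling of lists.\<close>

definition av312 :: "nat list \<Rightarrow> bool" where
  "av312 c \<longleftrightarrow> (\<forall>x y z. subseq [x, y, z] c \<longrightarrow> \<not> (y < z \<and> z < x))"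

text \<open>\<open>R\<close> stands for \<sigma>: \<open>R a b d\<close> is to say that three
  values, read from left to right, are ordered like it. \<open>E\<close> is the graph of a
  permutation or a part of one, so that single edges can be added or removed.\<close>

definition avoids :: "(nat \<Rightarrow> nat \<Rightarrow> nat \<Rightarrow> bool) \<Rightarrow> (nat \<times> nat) set \<Rightarrow> bool" where
  "avoids R E \<longleftrightarrow> (\<forall>i a j b k d. (i, a) \<in> E \<and> (j, b) \<in> E \<and> (k, d) \<in> E \<and> i < j \<and> j < k \<longrightarrow> \<not> R a b d)"

definition good :: "(nat \<Rightarrow> nat \<Rightarrow> nat \<Rightarrow> bool) \<Rightarrow> nat \<Rightarrow> nat list set" where
  "good R n = {c \<in> words n. av312 c \<and> avoids R (cyc c)}"

section \<open>Subsequences of two and three entries\<close>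

lemma subseq2_Cons: "subseq [y, z] (a # c) \<longleftrightarrow> y = a \<and> z \<in> set c \<or> subseq [y, z] c"
  by (metis subseq_Cons' subseq_Cons2_neq subseq_Cons2_iff subseq_singleton_left)

lemma subseq3_Cons: "subseq [x, y, z] (a # c) \<longleftrightarrow> x = a \<and> subseq [y, z] c \<or> subseq [x, y, z] c"
  by (metis subseq_Cons' subseq_Cons2_neq subseq_Cons2_iff)

lemma subseq2_append:
  "subseq [y, z] (as @ bs) \<longleftrightarrow>
     subseq [y, z] as \<or> y \<in> set as \<and> z \<in> set bs \<or> subseq [y, z] bs"
  by (induction as) (auto simp: subseq2_Cons subseq_singleton_left simp del: subseq_Cons2_iff)

lemma subseq3_append:
  "subseq [x, y, z] (as @ bs) \<longleftrightarrow>
     subseq [x, y, z] as \<or> subseq [x, y] as \<and> z \<in> set bs \<or>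
     x \<in> set as \<and> subseq [y, z] bs \<or> subseq [x, y, z] bs"
  by (induction as) (auto simp: subseq3_Cons subseq2_Cons subseq2_append subseq_singleton_left simp del: subseq_Cons2_iff)

lemma subseq2_map: "subseq [y, z] (map f c) \<longleftrightarrow> (\<exists>y' z'. y = f y' \<and> z = f z' \<and> subseq [y', z'] c)"
  by (induction c) (auto simp: subseq2_Cons simp del: subseq_Cons2_iff)

lemma subseq3_map:
  "subseq [x, y, z] (map f c) \<longleftrightarrow>
     (\<exists>x' y' z'. x = f x' \<and> y = f y' \<and> z = f z' \<and> subseq [x', y', z'] c)"
  by (induction c) (auto simp: subseq3_Cons subseq2_map simp del: subseq_Cons2_iff)

lemma subseq2_set: "subseq [y, z] c \<Longrightarrow> y \<in> set c \<and> z \<in> set c"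
  by (induction c) (auto simp: subseq2_Cons simp del: subseq_Cons2_iff)

lemma subseq2_nth: "subseq [y, z] c \<longleftrightarrow> (\<exists>i j. i < j \<and> j < length c \<and> c ! i = y \<and> c ! j = z)"
proof (induction c)
  case (Cons a c)
  show ?case (is "?L \<longleftrightarrow> ?R")
  proof
    assume ?L
    then consider "y = a" "z \<in> set c" | "subseq [y, z] c" by (auto simp: subseq2_Cons simp del: subseq_Cons2_iff)
    then show ?R
    proof cases
      case 1
      then obtain j where "j < length c" "c ! j = z" by (auto simp: in_set_conv_nth)
      then show ?thesis using 1 by (intro exI[of _ 0] exI[of _ "Suc j"]) auto
    next
      case 2
      then obtain i j where "i < j" "j < length c" "c ! i = y" "c ! j = z" using Cons by auto
      then show ?thesis by (intro exI[of _ "Suc i"] exI[of _ "Suc j"]) auto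
    qed
  next
    assume ?R
    then obtain i j where ij: "i < j" "j < length (a # c)" "(a # c) ! i = y" "(a # c) ! j = z" by auto
    then obtain j' where j': "j = Suc j'" by (cases j) auto
    show ?L using ij j' Cons by (cases i) (auto simp: subseq2_Cons simp del: subseq_Cons2_iff)
  qed
qed auto

lemma subseq3_nth:
  "subseq [x, y, z] c \<longleftrightarrow>
     (\<exists>i j k. i < j \<and> j < k \<and> k < length c \<and> c ! i = x \<and> c ! j = y \<and> c ! k = z)"
proof (induction c)
  case (Cons a c)
  show ?case (is "?L \<longleftrightarrow> ?R")
  proof
    assume ?L
    then consider "x = a" "subseq [y, z] c" | "subseq [x, y, z] c" by (auto simp: subseq3_Cons simp del: subseq_Cons2_iff)
    then show ?R
    proof cases
      case 1
      then obtain j k where "j < k" "k < length c" "c ! j = y" "c ! k = z" by (auto simp: subseq2_nth)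
      then show ?thesis using 1 by (intro exI[of _ 0] exI[of _ "Suc j"] exI[of _ "Suc k"]) auto
    next
      case 2
      then obtain i j k where "i < j" "j < k" "k < length c" "c ! i = x" "c ! j = y" "c ! k = z"
        using Cons by auto
      then show ?thesis by (intro exI[of _ "Suc i"] exI[of _ "Suc j"] exI[of _ "Suc k"]) auto
    qed
  next
    assume ?R
    then obtain i j k where ij: "i < j" "j < k" "k < length (a # c)" "(a # c) ! i = x"
      "(a # c) ! j = y" "(a # c) ! k = z" by auto
    then obtain j' k' where j': "j = Suc j'" "k = Suc k'" by (cases j; cases k) auto
    show ?L using ij j' Cons by (cases i) (auto simp: subseq3_Cons subseq2_nth simp del: subseq_Cons2_iff)
  qed
qed auto

section \<open>Edges of a path and basic facts about words\<close>

lemma steps_Cons: "ys \<noteq> [] \<Longrightarrow> steps (x # ys) = insert (x, hd ys) (steps ys)"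
  by (cases ys) auto

lemma steps_append:
  "xs \<noteq> [] \<Longrightarrow> ys \<noteq> [] \<Longrightarrow> steps (xs @ ys) = steps xs \<union> insert (last xs, hd ys) (steps ys)"
  by (induction xs rule: steps.induct) (auto simp: steps_Cons)

lemma steps_map: "steps (map f xs) = map_prod f f ` steps xs"
  by (induction xs rule: steps.induct) auto

lemma steps_nth: "steps c = {(c ! i, c ! Suc i) | i. Suc i < length c}"
proof (induction c rule: steps.induct)
  case (1 x y zs)
  have "{((x # y # zs) ! i, (x # y # zs) ! Suc i) |i. Suc i < length (x # y # zs)} =
     insert (x, y) {((y # zs) ! i, (y # zs) ! Suc i) |i. Suc i < length (y # zs)}" (is "?L = ?R")
  proof (intro equalityI subsetI)
    fix e assume "e \<in> ?L"
    then obtain i where "e = ((x # y # zs) ! i, (x # y # zs) ! Suc i)" "Suc i < length (x # y # zs)" by blast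
    then show "e \<in> ?R" by (cases i) auto
  next
    fix e assume "e \<in> ?R"
    then consider "e = (x, y)" | i where "e = ((y # zs) ! i, (y # zs) ! Suc i)" "Suc i < length (y # zs)" by blast
    then show "e \<in> ?L"
    proof cases
      case 1 then show ?thesis by (auto intro!: exI[of _ 0])
    next
      case 2 then show ?thesis by (auto intro!: exI[of _ "Suc i"])
    qed
  qed
  then show ?case using 1 by simp
qed auto

lemma steps_subset: "steps c \<subseteq> set c \<times> set (tl c)"
  by (induction c rule: steps.induct) auto

lemma words_length: "c \<in> words n \<Longrightarrow> length c = n"
  unfolding words_def by (metis (mono_tags, lifting) card_atLeastAtMost diff_Suc_1 distinct_card mem_Collect_eq)

lemma words_nth_0: "c \<in> words n \<Longrightarrow> c ! 0 = 1"
  by (auto simp: words_def hd_conv_nth)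

lemma finite_words: "finite (words n)"
  by (rule finite_subset[OF _ finite_lists_length_eq[of "{1..n}" n]])
    (use words_length in \<open>auto simp: words_def\<close>)

lemma finite_good: "finite (good R n)"
  using finite_words by (auto simp: good_def)

subsection \<open>Cyclic permutations as words\<close>

text \<open>An embedding of a three-letter pattern is a choice of three increasing positions. The
  diagonal comparisons are trivial; of the others both directions are kept, since no list is assumed
  to have distinct entries.\<close>

lemma contains_pattern_3:
  "contains_pattern w [a, b, d] \<longleftrightarrow>
     (\<exists>i j k. i < j \<and> j < k \<and> k < length w \<and>
       (w ! i < w ! j \<longleftrightarrow> a < b) \<and> (w ! j < w ! i \<longleftrightarrow> b < a) \<and>
       (w ! i < w ! k \<longleftrightarrow> a < d) \<and> (w ! k < w ! i \<longleftrightarrow> d < a) \<and>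
       (w ! j < w ! k \<longleftrightarrow> b < d) \<and> (w ! k < w ! j \<longleftrightarrow> d < b))" (is "?L \<longleftrightarrow> ?R")
proof
  assume ?L
  then obtain f :: "nat \<Rightarrow> nat" where f: "strict_mono_on {..<3} f" "f ` {..<3} \<subseteq> {..<length w}"
    "\<forall>x<3. \<forall>y<3. w ! f x < w ! f y \<longleftrightarrow> [a, b, d] ! x < [a, b, d] ! y"
    unfolding contains_pattern_def by (auto simp: numeral_3_eq_3)
  have "f 0 < f 1" "f 1 < f 2" "f 2 < length w"
    using f(1,2) by (auto simp: strict_mono_on_def image_subset_iff)
  moreover have "w ! f x < w ! f y \<longleftrightarrow> [a, b, d] ! x < [a, b, d] ! y" if "x < 3" "y < 3" for x y
    using f(3) that by blast
  from this[of 0 1] this[of 1 0] this[of 0 2] this[of 2 0] this[of 1 2] this[of 2 1]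
  have "(w ! f 0 < w ! f 1 \<longleftrightarrow> a < b) \<and> (w ! f 1 < w ! f 0 \<longleftrightarrow> b < a) \<and>
       (w ! f 0 < w ! f 2 \<longleftrightarrow> a < d) \<and> (w ! f 2 < w ! f 0 \<longleftrightarrow> d < a) \<and>
       (w ! f 1 < w ! f 2 \<longleftrightarrow> b < d) \<and> (w ! f 2 < w ! f 1 \<longleftrightarrow> d < b)" by simp
  ultimately show ?R by blast
next
  assume ?R
  then obtain i j k where ijk: "i < j" "j < k" "k < length w"
     and "(w ! i < w ! j \<longleftrightarrow> a < b)" "(w ! j < w ! i \<longleftrightarrow> b < a)"
       "(w ! i < w ! k \<longleftrightarrow> a < d)" "(w ! k < w ! i \<longleftrightarrow> d < a)"
       "(w ! j < w ! k \<longleftrightarrow> b < d)" "(w ! k < w ! j \<longleftrightarrow> d < b)" by blast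
  then have "\<forall>x<3. \<forall>y<3. w ! ([i, j, k] ! x) < w ! ([i, j, k] ! y) \<longleftrightarrow> [a, b, d] ! x < [a, b, d] ! y"
    by (auto simp: numeral_3_eq_3 less_Suc_eq)
  moreover have "strict_mono_on {..<3} ((!) [i, j, k])"
    using ijk by (auto simp: strict_mono_on_def numeral_3_eq_3 less_Suc_eq)
  moreover have "(!) [i, j, k] ` {..<3} \<subseteq> {..<length w}"
    using ijk by (auto simp: numeral_3_eq_3 less_Suc_eq)
  ultimately show ?L unfolding contains_pattern_def
    by (intro exI[of _ "(!) [i, j, k]"]) (auto simp: numeral_3_eq_3)
qed

lemma avoids_cycle_notation: "avoids_pattern c [3, 1, 2] \<longleftrightarrow> av312 c"
proof -
  have "(x < y \<longleftrightarrow> (3::nat) < 1) \<and> (y < x \<longleftrightarrow> (1::nat) < 3) \<and> (x < z \<longleftrightarrow> (3::nat) < 2) \<and>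
      (z < x \<longleftrightarrow> (2::nat) < 3) \<and> (y < z \<longleftrightarrow> (1::nat) < 2) \<and> (z < y \<longleftrightarrow> (2::nat) < 1) \<longleftrightarrow>
      y < z \<and> z < x" for x y z :: nat by auto
  then have "contains_pattern c [3, 1, 2] \<longleftrightarrow>
      (\<exists>i j k. i < j \<and> j < k \<and> k < length c \<and> c ! j < c ! k \<and> c ! k < c ! i)"
    unfolding contains_pattern_3 by presburger
  then show ?thesis unfolding av312_def subseq3_nth by blast
qed

text \<open>The hypothesis makes \<open>R\<close> the order type of the pattern, so that all six
  \<sigma> are covered at once. List positions start at 0 and sources of edges at 1, hence the
  shifts by \<open>Suc\<close>.\<close>

lemma avoids_one_line:
  assumes R: "\<And>x y z. R x y z \<longleftrightarrow> (x < y \<longleftrightarrow> a < b) \<and> (y < x \<longleftrightarrow> b < a) \<and>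
       (x < z \<longleftrightarrow> a < d) \<and> (z < x \<longleftrightarrow> d < a) \<and>
       (y < z \<longleftrightarrow> b < d) \<and> (z < y \<longleftrightarrow> d < b)"
  shows "avoids_pattern (one_line n \<pi>) [a, b, d] \<longleftrightarrow> avoids R {(x, \<pi> x) | x. x \<in> {1..n}}"
proof -
  have nth: "one_line n \<pi> ! i = \<pi> (Suc i)" if "i < n" for i
    using that unfolding one_line_def by (simp del: upt_Suc)
  have len: "length (one_line n \<pi>) = n"
    unfolding one_line_def by simp
  have "contains_pattern (one_line n \<pi>) [a, b, d] \<longleftrightarrow>
     (\<exists>i j k. i < j \<and> j < k \<and> k < n \<and> R (\<pi> (Suc i)) (\<pi> (Suc j)) (\<pi> (Suc k)))"
    unfolding contains_pattern_3 len by (simp only: R[symmetric]) (simp add: nth cong: conj_cong)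
  also have "\<dots> \<longleftrightarrow> (\<exists>i j k. 1 \<le> i \<and> i < j \<and> j < k \<and> k \<le> n \<and> R (\<pi> i) (\<pi> j) (\<pi> k))" (is "?L \<longleftrightarrow> ?R")
  proof
    assume ?L
    then obtain i j k where "i < j \<and> j < k \<and> k < n \<and> R (\<pi> (Suc i)) (\<pi> (Suc j)) (\<pi> (Suc k))" by blast
    then show ?R by (intro exI[of _ "Suc i"] exI[of _ "Suc j"] exI[of _ "Suc k"]) auto
  next
    assume ?R
    then obtain i j k where "1 \<le> i \<and> i < j \<and> j < k \<and> k \<le> n \<and> R (\<pi> i) (\<pi> j) (\<pi> k)" by blast
    then show ?L by (intro exI[of _ "i - 1"] exI[of _ "j - 1"] exI[of _ "k - 1"]) auto
  qed
  also have "\<dots> \<longleftrightarrow> (\<exists>i j k. i \<in> {1..n} \<and> j \<in> {1..n} \<and> k \<in> {1..n} \<and> i < j \<and> j < k \<and> R (\<pi> i) (\<pi> j) (\<pi> k))"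
    by (intro ex_cong1) auto
  also have "\<dots> \<longleftrightarrow> \<not> avoids R {(x, \<pi> x) | x. x \<in> {1..n}}"
    unfolding avoids_def by blast
  finally show ?thesis by blast
qed

text \<open>The orbit of 1 has \<open>n\<close> elements, so no positive power of \<pi> below the
  \<open>n\<close>-th fixes 1; injectivity of the powers turns this into distinctness of the
  entries.\<close>

lemma cycle_notation_cyclic:
  assumes n: "1 \<le> n" and perm: "\<pi> permutes {1..n}" and cyclic: "cyclic_on \<pi> {1..n}"
  shows "cycle_notation n \<pi> \<in> words n" and "cyc (cycle_notation n \<pi>) = {(x, \<pi> x) | x. x \<in> {1..n}}"
proof -
  let ?c = "cycle_notation n \<pi>"
  have orb: "orbit \<pi> 1 = {1..n}"
    using cyclic n by (metis atLeastAtMost_iff le_refl orbit_cyclic_eq3)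
  have no_return: "(\<pi> ^^ k) 1 \<noteq> 1" if "0 < k" "k < n" for k
  proof
    assume "(\<pi> ^^ k) 1 = 1"
    then have "orbit \<pi> 1 = (\<lambda>m. (\<pi> ^^ m) 1) ` {..<k}"
      using orbit_altdef_bounded[of k \<pi> 1] that by auto
    then have "card {1..n} \<le> k"
      using orb card_image_le[of "{..<k}" "\<lambda>m. (\<pi> ^^ m) 1"] by simp
    then show False using that by simp
  qed
  have inj: "inj (\<pi> ^^ i)" for i using perm by (simp add: permutes_inj inj_fn)
  have dist: "i = j" if "i \<le> j" "j < n" "(\<pi> ^^ i) 1 = (\<pi> ^^ j) 1" for i j
  proof (rule ccontr)
    assume "i \<noteq> j"
    have "(\<pi> ^^ i) ((\<pi> ^^ (j - i)) 1) = (\<pi> ^^ i) 1"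
      using that by (metis add_diff_inverse_nat comp_apply funpow_add linorder_not_less)
    then have "(\<pi> ^^ (j - i)) 1 = 1" using inj by (meson injD)
    moreover have "0 < j - i" "j - i < n" using that \<open>i \<noteq> j\<close> by linarith+
    ultimately show False using no_return by blast
  qed
  have injc: "inj_on (\<lambda>i. (\<pi> ^^ i) 1) {0..<n}"
    by (rule inj_onI) (metis atLeastLessThan_iff dist nat_le_linear)
  then have distinct: "distinct ?c" by (simp add: cycle_notation_def distinct_map)
  have mem: "(\<pi> ^^ i) 1 \<in> {1..n}" for i
  proof (induction i)
    case 0 then show ?case using n by simp
  next
    case (Suc i)
    then show ?case using permutes_in_image[OF perm, of "(\<pi> ^^ i) 1"] by simp
  qed
  have set: "set ?c = {1..n}"
  proof (rule card_subset_eq)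
    show "set ?c \<subseteq> {1..n}" using mem by (auto simp: cycle_notation_def)
    show "card (set ?c) = card {1..n}"
      by (simp add: distinct_card distinct) (simp add: cycle_notation_def)
  qed simp
  have ne: "?c \<noteq> []" using n by (simp add: cycle_notation_def)
  have nth: "?c ! i = (\<pi> ^^ i) 1" if "i < n" for i
    using that by (simp add: cycle_notation_def)
  have len: "length ?c = n" by (simp add: cycle_notation_def)
  have hd: "hd ?c = 1" using nth[of 0] n ne by (simp add: hd_conv_nth)
  show "?c \<in> words n" using distinct set ne hd by (simp add: words_def)
  have ret: "(\<pi> ^^ n) 1 = 1"
  proof -
    \<comment> \<open>The entries already exhaust \<open>{1..n}\<close>, so the \<open>n\<close>-th
      power lands on one of them. \<open>j > 0\<close> would mean a return to 1 after only
      \<open>n - j\<close> steps.\<close>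
    obtain j where j: "j < n" "(\<pi> ^^ n) 1 = (\<pi> ^^ j) 1"
      using mem[of n] set len nth by (metis in_set_conv_nth)
    have "j = 0"
    proof (rule ccontr)
      assume "j \<noteq> 0"
      have "(\<pi> ^^ j) ((\<pi> ^^ (n - j)) 1) = (\<pi> ^^ j) 1"
        using j by (metis add_diff_inverse_nat comp_apply funpow_add less_imp_le linorder_not_less)
      then have "(\<pi> ^^ (n - j)) 1 = 1" using inj by (meson injD)
      moreover have "0 < n - j" "n - j < n" using j \<open>j \<noteq> 0\<close> by linarith+
      ultimately show False using no_return by blast
    qed
    then show ?thesis using j by simp
  qed
  have last: "last ?c = (\<pi> ^^ (n - 1)) 1"
    using nth[of "n - 1"] n ne len by (simp add: last_conv_nth)
  have pl: "\<pi> (last ?c) = 1"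
    using ret n last by (metis One_nat_def Suc_pred comp_apply funpow.simps(2) less_eq_Suc_le)
  have pn: "\<pi> (?c ! i) = ?c ! Suc i" if "Suc i < n" for i
    using nth[of i] nth[of "Suc i"] that by simp
  have "{(x, \<pi> x) | x. x \<in> {1..n}} = {(?c ! i, \<pi> (?c ! i)) | i. i < n}"
    using set len by (metis (no_types, opaque_lifting) in_set_conv_nth)
  also have "\<dots> = insert (last ?c, 1) {(?c ! i, ?c ! Suc i) | i. Suc i < n}"
  proof (intro equalityI subsetI)
    fix e assume "e \<in> {(?c ! i, \<pi> (?c ! i)) | i. i < n}"
    then obtain i where i: "e = (?c ! i, \<pi> (?c ! i))" "i < n" by blast
    show "e \<in> insert (last ?c, 1) {(?c ! i, ?c ! Suc i) | i. Suc i < n}"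
    proof (cases "Suc i < n")
      case True
      then show ?thesis using i pn[OF True] by blast
    next
      case False
      then have "i = n - 1" using i by auto
      then have "?c ! i = last ?c" using ne len by (simp add: last_conv_nth)
      then show ?thesis using i pl by simp
    qed
  next
    fix e assume "e \<in> insert (last ?c, 1) {(?c ! i, ?c ! Suc i) | i. Suc i < n}"
    then consider "e = (last ?c, 1)" | i where "Suc i < n" "e = (?c ! i, ?c ! Suc i)" by blast
    then show "e \<in> {(?c ! i, \<pi> (?c ! i)) | i. i < n}"
    proof cases
      case 1
      then show ?thesis using pl n ne len
        by (intro CollectI exI[of _ "n - 1"]) (auto simp: last_conv_nth)
    next
      case 2
      then show ?thesis using pn by (intro CollectI exI[of _ i]) auto
    qed
  qed
  finally show "cyc ?c = {(x, \<pi> x) | x. x \<in> {1..n}}"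
    by (simp add: cyc_def steps_nth len hd)
qed

text \<open>The witness is \<open>cycle_of_list c\<close>: its \<open>i\<close>-th power rotates the
  list by \<open>i\<close>, so its powers at the head 1 read off \<open>c\<close>.\<close>

lemma word_cycle_notation:
  assumes "c \<in> words n"
  obtains \<pi> where "\<pi> permutes {1..n}" "cyclic_on \<pi> {1..n}" "cycle_notation n \<pi> = c"
proof
  let ?f = "cycle_of_list c"
  have c: "distinct c" "set c = {1..n}" "c \<noteq> []" "hd c = 1" "length c = n"
    using assms words_length by (auto simp: words_def)
  show perm: "?f permutes {1..n}" using c cycle_permutes[of c] by simp
  have pow: "(?f ^^ i) 1 = c ! i" if "i < n" for i
  proof -
    have "map (?f ^^ i) c = rotate i c" using c(1) by (rule cyclic_rotation)
    then have "(?f ^^ i) (hd c) = hd (rotate i c)" using c(3) by (metis hd_map)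
    then show ?thesis using c that by (simp add: hd_rotate_conv_nth)
  qed
  show "cycle_notation n ?f = c"
    by (rule nth_equalityI) (use pow c in \<open>auto simp: cycle_notation_def\<close>)
  have one: "1 \<in> {1..n}" using c by (metis hd_in_set)
  have "orbit ?f 1 \<subseteq> {1..n}"
    using permutes_orbit_subset[OF perm one] .
  moreover have "{1..n} \<subseteq> orbit ?f 1"
  proof
    fix x assume "x \<in> {1..n}"
    then obtain i where i: "i < n" "c ! i = x" using c by (metis in_set_conv_nth)
    have self: "1 \<in> orbit ?f 1"
      using perm one by (meson finite_atLeastAtMost permutation_permutes permutation_self_in_orbit)
    show "x \<in> orbit ?f 1"
      using pow[OF i(1)] i(2) self by (metis funpow_in_orbit)
  qed
  ultimately show "cyclic_on ?f {1..n}" unfolding cyclic_on_def using one by blast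
qed

text \<open>Passing to the cycle notation is injective because the edges of the cycle are the graph
  of the permutation on \<open>{1..n}\<close>, and outside it is the identity.\<close>

lemma num_cyclic_avoiders_eq_card_good:
  assumes n: "1 \<le> n"
    and R: "\<And>x y z. R x y z \<longleftrightarrow> (x < y \<longleftrightarrow> a < b) \<and> (y < x \<longleftrightarrow> b < a) \<and>
       (x < z \<longleftrightarrow> a < d) \<and> (z < x \<longleftrightarrow> d < a) \<and>
       (y < z \<longleftrightarrow> b < d) \<and> (z < y \<longleftrightarrow> d < b)"
  shows "num_cyclic_avoiders n [a, b, d] [3, 1, 2] = card (good R n)"
proof -
  let ?S = "cyclic_avoiders n [a, b, d] [3, 1, 2]"
  have "inj_on (cycle_notation n) ?S"
  proof (rule inj_onI)
    fix \<pi> \<rho> assume S: "\<pi> \<in> ?S" "\<rho> \<in> ?S" and eq: "cycle_notation n \<pi> = cycle_notation n \<rho>"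
    then have p: "\<pi> permutes {1..n}" "cyclic_on \<pi> {1..n}" "\<rho> permutes {1..n}" "cyclic_on \<rho> {1..n}"
      by (auto simp: cyclic_avoiders_def)
    have "{(x, \<pi> x) | x. x \<in> {1..n}} = {(x, \<rho> x) | x. x \<in> {1..n}}"
      using cycle_notation_cyclic(2)[OF n p(1,2)] cycle_notation_cyclic(2)[OF n p(3,4)] eq by simp
    then have "\<pi> x = \<rho> x" if "x \<in> {1..n}" for x using that by blast
    moreover have "\<pi> x = \<rho> x" if "x \<notin> {1..n}" for x using p that by (metis permutes_not_in)
    ultimately show "\<pi> = \<rho>" by blast
  qed
  moreover have "cycle_notation n ` ?S = good R n"
  proof (intro equalityI subsetI)
    fix c assume "c \<in> cycle_notation n ` ?S"
    then obtain \<pi> where \<pi>: "\<pi> \<in> ?S" and c: "c = cycle_notation n \<pi>" by blast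
    then have p: "\<pi> permutes {1..n}" "cyclic_on \<pi> {1..n}"
      by (auto simp: cyclic_avoiders_def)
    show "c \<in> good R n"
      using \<pi> cycle_notation_cyclic[OF n p] avoids_one_line[OF R, of n \<pi>] avoids_cycle_notation[of c]
      unfolding c good_def cyclic_avoiders_def by auto
  next
    fix c assume c: "c \<in> good R n"
    then obtain \<pi> where p: "\<pi> permutes {1..n}" "cyclic_on \<pi> {1..n}" "cycle_notation n \<pi> = c"
      using word_cycle_notation[of c n] unfolding good_def by blast
    then show "c \<in> cycle_notation n ` ?S"
      using c cycle_notation_cyclic[OF n p(1,2)] avoids_one_line[OF R, of n \<pi>] avoids_cycle_notation[of c]
      unfolding good_def cyclic_avoiders_def by auto
  qed
  ultimately show ?thesis unfolding num_cyclic_avoiders_def by (metis card_image)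
qed

text \<open>
  In these locales \<open>p x\<close> is the position of \<open>x\<close> in the cycle notation, counted from 0, and
  \<open>nx x = \<pi>(x)\<close> is its cyclic successor.
\<close>

locale word =
  fixes n :: nat and c :: "nat list"
  assumes word: "c \<in> words n"
begin

definition p :: "nat \<Rightarrow> nat" where
  "p x = (THE i. i < n \<and> c ! i = x)"

definition nx :: "nat \<Rightarrow> nat" where
  "nx x = (if p x + 1 < n then c ! (p x + 1) else 1)"

lemma distinct: "distinct c" and set_c: "set c = {1..n}" and len: "length c = n" and c_0: "c ! 0 = 1"
  using word words_length words_nth_0 by (auto simp: words_def)

lemma n_pos: "0 < n"
  using word words_length by (auto simp: words_def)

lemma p_nth: "i < n \<Longrightarrow> p (c ! i) = i"
  unfolding p_def using distinct len by (auto simp: nth_eq_iff_index_eq)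

lemma p_less: "x \<in> {1..n} \<Longrightarrow> p x < n" and nth_p: "x \<in> {1..n} \<Longrightarrow> c ! p x = x"
  by (metis in_set_conv_nth p_nth set_c len)+

lemma nth_mem: "i < n \<Longrightarrow> c ! i \<in> {1..n}"
  using set_c len nth_mem by metis

lemma p_eq: "x \<in> {1..n} \<Longrightarrow> y \<in> {1..n} \<Longrightarrow> p x = p y \<longleftrightarrow> x = y"
  by (metis nth_p)

lemma one_mem: "1 \<in> {1..n}"
  using n_pos by simp

lemma p_1: "p 1 = 0"
  using p_nth[of 0] c_0 n_pos by simp

lemma p_pos: "x \<in> {1..n} \<Longrightarrow> x \<noteq> 1 \<Longrightarrow> 0 < p x"
  using p_eq[OF _ one_mem] p_1 by (metis gr0I)

lemma nx_mem: "x \<in> {1..n} \<Longrightarrow> nx x \<in> {1..n}"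
  unfolding nx_def using nth_mem one_mem by simp

lemma nx_1_iff: "x \<in> {1..n} \<Longrightarrow> nx x = 1 \<longleftrightarrow> p x + 1 = n"
  unfolding nx_def using p_less[of x] p_nth[of "p x + 1"] p_1 by auto

lemma p_nx: "x \<in> {1..n} \<Longrightarrow> nx x \<noteq> 1 \<Longrightarrow> p (nx x) = p x + 1"
  unfolding nx_def using p_nth[of "p x + 1"] by (auto split: if_splits)

lemma nx_eqI: "x \<in> {1..n} \<Longrightarrow> y \<in> {1..n} \<Longrightarrow> p y = p x + 1 \<Longrightarrow> nx x = y"
  by (metis nth_p nx_def p_less)

lemma nx_neq: "x \<in> {1..n} \<Longrightarrow> 2 \<le> n \<Longrightarrow> nx x \<noteq> x"
  using p_nx[of x] nx_1_iff[of x] p_1 by (metis Suc_eq_plus1 n_not_Suc_n not_numeral_le_zero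
    numeral_le_one_iff plus_nat.add_0 semiring_norm(69))

lemma pred: "y \<in> {1..n} \<Longrightarrow> \<exists>x\<in>{1..n}. nx x = y"
proof (cases "y = 1")
  case True
  have "p (c ! (n - 1)) = n - 1" "c ! (n - 1) \<in> {1..n}"
    using p_nth[of "n - 1"] nth_mem[of "n - 1"] n_pos by auto
  then have "nx (c ! (n - 1)) = 1" using nx_1_iff n_pos by simp
  then show ?thesis using True \<open>c ! (n - 1) \<in> {1..n}\<close> by blast
next
  case False
  assume y: "y \<in> {1..n}"
  have p: "0 < p y" "p y < n" using False y p_pos p_less by auto
  then have "p (c ! (p y - 1)) = p y - 1" "c ! (p y - 1) \<in> {1..n}"
    using p_nth[of "p y - 1"] nth_mem[of "p y - 1"] by auto
  then have "nx (c ! (p y - 1)) = y" using nx_eqI[of "c ! (p y - 1)" y] y p by simp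
  then show ?thesis using \<open>c ! (p y - 1) \<in> {1..n}\<close> by blast
qed

lemma nx_inj: "x \<in> {1..n} \<Longrightarrow> y \<in> {1..n} \<Longrightarrow> nx x = nx y \<Longrightarrow> x = y"
  by (metis add_right_cancel nx_1_iff p_eq p_nx)

lemma last_c: "last c = c ! (n - 1)"
  using len n_pos by (metis last_conv_nth length_greater_0_conv)

lemma p_last: "x \<in> {1..n} \<Longrightarrow> p x + 1 = n \<longleftrightarrow> last c = x"
  unfolding last_c using p_nth[of "n - 1"] nth_p[of x] n_pos by (metis One_nat_def Suc_pred add.commute diff_less lessI
    plus_1_eq_Suc diff_Suc_1)

lemma steps_c: "steps c = {(x, nx x) | x. x \<in> {1..n} \<and> p x + 1 < n}"
proof -
  have "steps c = {(c ! i, c ! Suc i) | i. Suc i < n}" by (simp add: steps_nth len)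
  also have "\<dots> = {(x, nx x) | x. x \<in> {1..n} \<and> p x + 1 < n}"
  proof (intro equalityI subsetI)
    fix e assume "e \<in> {(c ! i, c ! Suc i) | i. Suc i < n}"
    then obtain i where i: "e = (c ! i, c ! Suc i)" "Suc i < n" by blast
    then have "nx (c ! i) = c ! Suc i" "c ! i \<in> {1..n}" "p (c ! i) + 1 < n"
      using p_nth[of i] nth_mem[of i] by (auto simp: nx_def)
    then show "e \<in> {(x, nx x) | x. x \<in> {1..n} \<and> p x + 1 < n}" using i by auto
  next
    fix e assume "e \<in> {(x, nx x) | x. x \<in> {1..n} \<and> p x + 1 < n}"
    then obtain x where x: "e = (x, nx x)" "x \<in> {1..n}" "p x + 1 < n" by blast
    then have "e = (c ! p x, c ! Suc (p x))" by (simp add: nx_def nth_p)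
    then show "e \<in> {(c ! i, c ! Suc i) | i. Suc i < n}" using x by auto
  qed
  finally show ?thesis .
qed

lemma cyc_c: "cyc c = {(x, nx x) | x. x \<in> {1..n}}"
proof -
  have mem: "last c \<in> {1..n}" using n_pos nth_mem[of "n - 1"] last_c by simp
  then have nx: "nx (last c) = 1" using nx_1_iff p_last by blast
  have hd: "hd c = 1" using word by (simp add: words_def)
  have other: "x = last c" if "x \<in> {1..n}" "\<not> p x + 1 < n" for x
    using that p_less[of x] p_last[of x] by simp
  show ?thesis unfolding cyc_def steps_c hd
  proof (intro equalityI subsetI)
    fix e assume "e \<in> insert (last c, 1) {(x, nx x) | x. x \<in> {1..n} \<and> p x + 1 < n}"
    then consider "e = (last c, 1)" | x where "e = (x, nx x)" "x \<in> {1..n}" by blast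
    then show "e \<in> {(x, nx x) | x. x \<in> {1..n}}" using mem nx by cases auto
  next
    fix e assume "e \<in> {(x, nx x) | x. x \<in> {1..n}}"
    then obtain x where "e = (x, nx x)" "x \<in> {1..n}" by blast
    then show "e \<in> insert (last c, 1) {(x, nx x) | x. x \<in> {1..n} \<and> p x + 1 < n}"
      using other[of x] nx by (cases "p x + 1 < n") auto
  qed
qed

lemma ends2:
  assumes "x \<in> {1..n}" "y \<in> {1..n}" "p y + 1 = n" "p x + 1 = p y"
  shows "\<exists>d. c = d @ [x, y]"
proof -
  have "drop (p x) c = c ! p x # drop (Suc (p x)) c" "drop (p y) c = c ! p y # drop (Suc (p y)) c"
    using assms p_less len by (metis Cons_nth_drop_Suc)+
  moreover have "drop (Suc (p y)) c = []" using assms(3) len by simp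
  ultimately have "drop (p x) c = [x, y]" using nth_p assms by simp
  then show ?thesis by (metis append_take_drop_id)
qed

end

subsection \<open>Structure of the words\<close>

text \<open>For \<open>n \<ge> 2\<close> the permutation with this cycle has the one-line notation
  \<open>n, 1, 2, ..., n - 1\<close>, which contains neither 132 nor 213.\<close>

definition dec :: "nat \<Rightarrow> nat list" where
  "dec n = 1 # rev [2..<Suc n]"

text \<open>All entries after \<open>n\<close> are smaller than it, so two of them in increasing
  order would complete a 312. Hence everything after 1 decreases.\<close>

lemma dec_unique:
  assumes c: "c \<in> words n" "av312 c" and n: "2 \<le> n" and m: "c ! 1 = n"
  shows "c = dec n"
proof -
  interpret word n c using c(1) by unfold_locales
  have less: "c ! j < c ! i" if "1 \<le> i" "i < j" "j < n" for i j
  proof (cases "i = 1")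
    case True
    have "c ! j \<in> {1..n}" "c ! j \<noteq> c ! 1" using nth_mem[of j] distinct len that by (auto simp: nth_eq_iff_index_eq)
    then show ?thesis using m True by auto
  next
    case False
    have "c ! j \<in> {1..n}" "c ! j \<noteq> c ! 1" "c ! i \<noteq> c ! j"
      using nth_mem[of j] distinct len that by (auto simp: nth_eq_iff_index_eq)
    moreover have "subseq [c ! 1, c ! i, c ! j] c"
      unfolding subseq3_nth using that False len by (intro exI[of _ 1] exI[of _ i] exI[of _ j]) auto
    ultimately show ?thesis using c(2) m unfolding av312_def
      by (metis atLeastAtMost_iff le_neq_implies_less linorder_neqE_nat)
  qed
  have c_Cons: "c = 1 # tl c" using c(1) by (cases c) (auto simp: words_def)
  have "sorted (rev (tl c))"
    unfolding sorted_iff_nth_mono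
  proof (intro allI impI)
    fix i j assume ij: "i \<le> j" "j < length (rev (tl c))"
    then have l: "j < n - 1" using len by simp
    have "rev (tl c) ! k = c ! (n - 1 - k)" if "k < n - 1" for k
      using that len by (simp add: rev_nth nth_tl Suc_diff_Suc)
    moreover have "c ! (n - 1 - i) < c ! (n - 1 - j)" if "i \<noteq> j"
      by (rule less) (use ij l that n_pos in linarith)+
    ultimately show "rev (tl c) ! i \<le> rev (tl c) ! j"
      using ij l by (cases "i = j") (auto intro: less_imp_le)
  qed
  moreover have "distinct (rev (tl c))" using distinct by (simp add: distinct_tl)
  moreover have "set (rev (tl c)) = set [2..<Suc n]"
    using set_c distinct c_Cons by (metis (no_types, lifting) Diff_insert_absorb atLeastAtMost_insertL
      atLeastLessThanSuc_atLeastAtMost distinct.simps(2) list.simps(15) n n_pos numeral_2_eq_2 One_nat_def set_rev set_upt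
      Suc_leI atLeastAtMost_iff not_less_eq_eq order_refl)
  ultimately have "rev (tl c) = [2..<Suc n]"
    by (intro sorted_distinct_set_unique) (auto simp del: upt_Suc)
  then show ?thesis using c_Cons unfolding dec_def by (metis rev_rev_ident)
qed

locale good_word =
  fixes n :: nat and c :: "nat list" and R :: "nat \<Rightarrow> nat \<Rightarrow> nat \<Rightarrow> bool"
  assumes good: "c \<in> good R n"
begin

sublocale word n c
  using good by unfold_locales (simp add: good_def)

lemma av:
  assumes "x \<in> {1..n}" "y \<in> {1..n}" "z \<in> {1..n}" "p x < p y" "p y < p z" "y < z" "z < x"
  shows False
proof -
  have "subseq [x, y, z] c"
    unfolding subseq3_nth using assms nth_p p_less len
    by (intro exI[of _ "p x"] exI[of _ "p y"] exI[of _ "p z"]) simp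
  then show False using good assms unfolding good_def av312_def by blast
qed

lemma avR:
  assumes "i \<in> {1..n}" "j \<in> {1..n}" "k \<in> {1..n}" "i < j" "j < k" "R (nx i) (nx j) (nx k)"
  shows False
proof -
  have "(i, nx i) \<in> cyc c" "(j, nx j) \<in> cyc c" "(k, nx k) \<in> cyc c" using assms(1-3) by (auto simp: cyc_c)
  then show False using good assms(4-6) unfolding good_def avoids_def by blast
qed

lemma nx1:
  assumes "2 \<le> n"
  shows "nx 1 \<in> {2..n}" "p (nx 1) = 1" "nx 1 = c ! 1" "x \<in> {1..n} \<Longrightarrow> x \<noteq> 1 \<Longrightarrow> x \<noteq> nx 1 \<Longrightarrow> 1 < p x"
proof -
  have 1: "nx 1 \<noteq> 1" using nx_neq[of 1] assms by simp
  then show m: "nx 1 \<in> {2..n}" using nx_mem[of 1] assms by auto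
  show p: "p (nx 1) = 1" using p_nx[of 1] 1 p_1 one_mem by simp
  show "nx 1 = c ! 1" using p_1 assms by (simp add: nx_def)
  show "1 < p x" if "x \<in> {1..n}" "x \<noteq> 1" "x \<noteq> nx 1"
    using p_pos[OF that(1,2)] p_eq[of x "nx 1"] p m that by auto
qed

lemma pred2:
  assumes "2 \<le> n"
  obtains t where "t \<in> {1..n}" "nx t = 2" "t \<noteq> 2" "p 2 = p t + 1"
proof -
  obtain t where t: "t \<in> {1..n}" "nx t = 2" using pred[of 2] assms by auto
  then show ?thesis using that[of t] nx_neq[of t] p_nx[of t] assms by auto
qed

lemma pred1:
  obtains q where "q \<in> {1..n}" "nx q = 1" "last c = q" "p q + 1 = n"
    "\<And>x. x \<in> {1..n} \<Longrightarrow> x \<noteq> q \<Longrightarrow> p x < p q"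
proof -
  obtain q where q: "q \<in> {1..n}" "nx q = 1" using pred[of 1] one_mem by auto
  then have l: "p q + 1 = n" "last c = q" using nx_1_iff p_last by auto
  have "p x < p q" if "x \<in> {1..n}" "x \<noteq> q" for x
    using p_less[of x] p_eq[of x q] l that q by auto
  then show ?thesis using that[of q] q l by auto
qed

end

text \<open>
  In the structure lemmas \<open>t = \<pi>\<^sup>-\<^sup>1(2)\<close>, \<open>r = \<pi>\<^sup>-\<^sup>1(n)\<close> and \<open>q = \<pi>\<^sup>-\<^sup>1(1)\<close> is the last entry of the cycle.
  Most contradictions come from the 312-patterns \<open>t, 2, q\<close> and \<open>t, 2, r\<close> in the cycle.
\<close>

lemma structure_321:
  assumes "c \<in> good (\<lambda>x y z. z < y \<and> y < x) n" "3 \<le> n"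
  shows "c ! 1 = 2 \<or> last c = 2"
proof (rule ccontr)
  assume neg: "\<not> ?thesis"
  interpret good_word n c "\<lambda>x y z. z < y \<and> y < x" using assms(1) by unfold_locales
  have n: "2 \<le> n" "2 \<in> {1..n}" using assms by auto
  note m = nx1[OF n(1)]
  obtain t where t: "t \<in> {1..n}" "nx t = 2" "t \<noteq> 2" "p 2 = p t + 1" using pred2[OF n(1)] by blast
  obtain q where q: "q \<in> {1..n}" "nx q = 1" "last c = q" "p q + 1 = n"
    "\<And>x. x \<in> {1..n} \<Longrightarrow> x \<noteq> q \<Longrightarrow> p x < p q" using pred1 by blast
  have "t \<noteq> 1" "q \<noteq> 2" using neg t m q by auto
  moreover have "q \<noteq> 1" using q(2) nx_neq[of 1] n(1) one_mem by auto
  moreover have "q \<noteq> t" using t q by auto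
  moreover have y: "nx 2 \<in> {1..n}" "nx 2 \<noteq> 1" "nx 2 \<noteq> 2"
    using nx_mem[of 2] nx_neq[of 2] nx_1_iff[of 2] p_last[of 2] neg n by auto
  \<comment> \<open>If \<open>t < q\<close>, the sources \<open>2 < t < q\<close> carry
    \<open>nx 2 > 2 > 1\<close>, a 321. If \<open>q < t\<close>, the cycle contains the 312
    \<open>t, 2, q\<close>.\<close>
  ultimately have "2 < t" "2 < q" "t < q \<or> q < t" "nx 2 > 2" using t q by auto
  then consider "t < q" | "q < t" by blast
  then show False
  proof cases
    case 1
    then show False using avR[of 2 t q] n t q y \<open>2 < t\<close> by auto
  next
    case 2
    have "p 2 < p q" using q(5)[of 2] n \<open>2 < q\<close> by auto
    then show False using av[of t 2 q] 2 t q n \<open>2 < q\<close> by auto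
  qed
qed

text \<open>If 2 were not last, then \<open>nx 1 < nx 2\<close>: this is clear for
  \<open>nx 1 = 2\<close>, and otherwise \<open>nx 1, 2, nx 2\<close> would be a 312 in the cycle.
  The sources \<open>1 < 2 < q\<close> then carry \<open>nx 1, nx 2, 1\<close>, a 231.\<close>

lemma structure_231:
  assumes "c \<in> good (\<lambda>x y z. z < x \<and> x < y) n" "3 \<le> n"
  shows "last c = 2"
proof (rule ccontr)
  assume neg: "\<not> ?thesis"
  interpret good_word n c "\<lambda>x y z. z < x \<and> x < y" using assms(1) by unfold_locales
  have n: "2 \<le> n" "2 \<in> {1..n}" using assms by auto
  note m = nx1[OF n(1)]
  obtain q where q: "q \<in> {1..n}" "nx q = 1" "last c = q" "p q + 1 = n"
    "\<And>x. x \<in> {1..n} \<Longrightarrow> x \<noteq> q \<Longrightarrow> p x < p q" using pred1 by blast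
  have y: "nx 2 \<in> {1..n}" "nx 2 \<noteq> 1" "nx 2 \<noteq> 2" "p (nx 2) = p 2 + 1"
    using nx_mem[of 2] nx_neq[of 2] nx_1_iff[of 2] p_last[of 2] p_nx[of 2] neg n by auto
  have q2: "2 < q" using q(2,3) nx_neq[of 1] n(1) one_mem neg q(1)
    by (metis Suc_1 Suc_leI atLeastAtMost_iff le_neq_implies_less One_nat_def)
  have my: "nx 1 < nx 2"
  proof (cases "nx 1 = 2")
    case True
    then show ?thesis using y by auto
  next
    case False
    then have "1 < p 2" using m(4)[of 2] n by auto
    have "nx 2 \<noteq> nx 1" using nx_inj[of 2 1] one_mem n by auto
    then show ?thesis using \<open>1 < p 2\<close> av[of "nx 1" 2 "nx 2"] \<open>1 < p 2\<close> y m n by fastforce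
  qed
  then show False using avR[of 1 2 q] q2 q n one_mem m by auto
qed

text \<open>The value 1 at source \<open>q\<close> cuts the one-line word: everything to its left
  exceeds everything to its right. For \<open>q < n\<close> this leaves only \<open>dec n\<close>;
  for \<open>q = n\<close> the cut is void, and the order of \<open>r\<close> and \<open>t\<close>
  decides.\<close>

lemma structure_213:
  assumes "c \<in> good (\<lambda>x y z. y < x \<and> x < z) n" "3 \<le> n"
  shows "c = dec n \<or> (c ! 1 = 2 \<and> last c = n) \<or> (\<exists>d. c = d @ [2, n])"
proof -
  interpret good_word n c "\<lambda>x y z. y < x \<and> x < z" using assms(1) by unfold_locales
  have n: "2 \<le> n" "2 \<in> {1..n}" "n \<in> {1..n}" using assms by auto
  note m = nx1[OF n(1)]
  have av312: "av312 c" using assms by (simp add: good_def)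
  obtain t where t: "t \<in> {1..n}" "nx t = 2" "t \<noteq> 2" "p 2 = p t + 1" using pred2[OF n(1)] by blast
  obtain q where q: "q \<in> {1..n}" "nx q = 1" "last c = q" "p q + 1 = n"
    "\<And>x. x \<in> {1..n} \<Longrightarrow> x \<noteq> q \<Longrightarrow> p x < p q" using pred1 by blast
  have q1: "q \<noteq> 1" using q(2) nx_neq[of 1] n(1) one_mem by auto
  obtain r where r: "r \<in> {1..n}" "nx r = n" using pred n by blast
  have rn: "r \<noteq> n" using nx_neq[of r] r n by auto
  have pr: "p n = p r + 1" using p_nx[of r] r assms(2) by auto
  have drop: "nx k < nx i" if "i < q" "q < k" "i \<in> {1..n}" "k \<in> {1..n}" for i k
  proof (rule ccontr)
    assume a: "\<not> nx k < nx i"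
    have "nx k \<noteq> nx i" using nx_inj[of k i] that by auto
    moreover have "nx i \<noteq> 1" using nx_inj[of i q] that q by auto
    moreover have "nx i \<in> {1..n}" using nx_mem that by auto
    ultimately show False using avR[of i q k] a that q by auto
  qed
  show ?thesis
  proof (cases "q = n")
    case False
    then have qn: "q < n" using q by auto
    have nxn: "nx n \<noteq> 1" using nx_inj[of n q] q n False by auto
    \<comment> \<open>If \<open>t < q\<close>, the cut puts \<open>nx n\<close> below
      \<open>nx t = 2\<close>, but the value 1 is taken by \<open>q\<close>. So
      \<open>q < t\<close>, and for \<open>q > 2\<close> the cycle contains
      \<open>t, 2, q\<close>.\<close>
    have "q = 2"
    proof (rule ccontr)
      assume "q \<noteq> 2"
      then have q2: "2 < q" using q1 q by auto
      have "q < t"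
      proof (rule ccontr)
        assume "\<not> q < t"
        moreover have "t \<noteq> q" using t q by auto
        ultimately have "nx n < nx t" using drop[of t n] qn t n by auto
        then show False using t nxn nx_mem[of n] n by auto
      qed
      moreover have "p 2 < p q" using q(5)[of 2] q2 n by auto
      ultimately show False using av[of t 2 q] t q n q2 by auto
    qed
    then have "nx 1 = n"
    proof -
      have "r \<noteq> q" using q r assms by auto
      moreover have "\<not> q < r"
      proof
        assume "q < r"
        then have "nx r < nx 1" using drop[of 1 r] \<open>q = 2\<close> r one_mem by auto
        then show False using r m by auto
      qed
      ultimately show ?thesis using r \<open>q = 2\<close> by (metis One_nat_def Suc_1 atLeastAtMost_iff le_antisym less_Suc_eq_le linorder_neqE_nat)
    qed
    then show ?thesis using dec_unique[OF word av312 n(1)] m by auto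
  next
    case True
    show ?thesis
    proof (cases "nx 1 = 2")
      case True
      then show ?thesis using m q \<open>q = n\<close> by auto
    next
      case False
      then have m3: "2 < nx 1" using m by auto
      have t1: "t \<noteq> 1" using t False by auto
      \<comment> \<open>For \<open>t < r\<close> the sources \<open>1 < t < r\<close> carry
        \<open>nx 1, 2, n\<close>, a 213. For \<open>r < t\<close> the cycle contains
        \<open>t, 2, r\<close>, since 2 precedes the final \<open>n\<close> and hence also
        \<open>r\<close>.\<close>
      have "r = 2"
      proof (rule ccontr)
        assume "r \<noteq> 2"
        have "r \<noteq> 1" using m(2) q(4) \<open>q = n\<close> r assms(2) by auto
        then have r2: "2 < r" using r \<open>r \<noteq> 2\<close> by auto
        have "\<not> t < r"
        proof
          assume "t < r"
          moreover have "nx 1 < n" using nx_inj[of 1 r] r \<open>r \<noteq> 1\<close> m one_mem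
            by (metis atLeastAtMost_iff le_neq_implies_less)
          ultimately show False using avR[of 1 t r] t1 t r one_mem m3 by auto
        qed
        moreover have "t \<noteq> r" using t r assms by auto
        ultimately have "r < t" by auto
        moreover have "p 2 < p n" using q(5)[of 2] \<open>q = n\<close> assms n by auto
        then have "p 2 < p r" using pr \<open>r \<noteq> 2\<close> p_eq[of 2 r] r n by auto
        ultimately show False using av[of t 2 r] t r n r2 by auto
      qed
      then show ?thesis using ends2[of 2 n] n pr q \<open>q = n\<close> by auto
    qed
  qed
qed

text \<open>Here the value \<open>n\<close> at source \<open>r\<close> cuts the one-line word, again
  with larger values on the left and smaller ones on the right. The three alternatives correspond to
  \<open>r = 1\<close>, \<open>r = n - 1\<close> and \<open>r = 2\<close>.\<close>

lemma structure_132: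
  assumes "c \<in> good (\<lambda>x y z. x < z \<and> z < y) n" "3 \<le> n"
  shows "c = dec n \<or> (\<exists>d. c = d @ [n - 1, n]) \<or> (c ! 1 = n - 1 \<and> last c = n)"
proof -
  interpret good_word n c "\<lambda>x y z. x < z \<and> z < y" using assms(1) by unfold_locales
  have n: "2 \<le> n" "2 \<in> {1..n}" "n \<in> {1..n}" "n - 1 \<in> {1..n}" using assms by auto
  note m = nx1[OF n(1)]
  have av312: "av312 c" using assms by (simp add: good_def)
  obtain t where t: "t \<in> {1..n}" "nx t = 2" "t \<noteq> 2" "p 2 = p t + 1" using pred2[OF n(1)] by blast
  obtain q where q: "q \<in> {1..n}" "nx q = 1" "last c = q" "p q + 1 = n"
    "\<And>x. x \<in> {1..n} \<Longrightarrow> x \<noteq> q \<Longrightarrow> p x < p q" using pred1 by blast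
  have q1: "q \<noteq> 1" using q(2) nx_neq[of 1] n(1) one_mem by auto
  obtain r where r: "r \<in> {1..n}" "nx r = n" using pred n by blast
  have rn: "r \<noteq> n" using nx_neq[of r] r n by auto
  have rq: "r \<noteq> q" using r q assms by auto
  have pr: "p n = p r + 1" using p_nx[of r] r assms(2) by auto
  have drop: "nx k < nx i" if "i < r" "r < k" "i \<in> {1..n}" "k \<in> {1..n}" for i k
  proof (rule ccontr)
    assume a: "\<not> nx k < nx i"
    have "nx k \<noteq> nx i" using nx_inj[of k i] that by auto
    moreover have "nx k \<noteq> n" using nx_inj[of k r] that r by auto
    moreover have "nx k \<in> {1..n}" using nx_mem that by auto
    ultimately show False using avR[of i r k] a that r by auto
  qed
  have nxn: "nx n \<in> {1..n}" using nx_mem n by blast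
  consider "r = 1" | "r \<noteq> 1" "r = n - 1" | "r \<noteq> 1" "r \<noteq> n - 1" by blast
  then show ?thesis
  proof cases
    case 1
    then show ?thesis using dec_unique[OF word av312 n(1)] m r by auto
  next
    case 2
    have "q = n"
    proof (rule ccontr)
      assume "q \<noteq> n"
      then have "q < r" using q rq 2 by auto
      then have "nx n < nx q" using drop[of q n] q n r rn by auto
      then show False using q nxn by auto
    qed
    then show ?thesis using ends2[of "n - 1" n] n pr q 2 by auto
  next
    case 3
    then have r': "1 < r" "r \<le> n - 2" "r < n - 1" using r rn by auto
    have "\<not> q < r"
    proof
      assume "q < r"
      then have "nx n < nx q" using drop[of q n] q n r' by auto
      then show False using q nxn by auto
    qed
    then have qr: "r < q" using rq by auto
    \<comment> \<open>Two sources, \<open>n - 1\<close> and \<open>n\<close>, lie to the right of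
      \<open>r\<close>. If \<open>t < r\<close>, both would need a value below 2, so
      \<open>r < t\<close>; and 2 comes before \<open>r\<close>, since otherwise
      \<open>n, 2, q\<close> is a 312. Then \<open>t, 2, r\<close> is a 312.\<close>
    have r2: "r = 2"
    proof (rule ccontr)
      assume "r \<noteq> 2"
      then have r3: "2 < r" using r' by auto
      have q2: "p 2 < p q" using q(5)[of 2] n r3 qr by auto
      have "p 2 < p r"
      proof (rule ccontr)
        assume "\<not> p 2 < p r"
        then have "p r < p 2" using p_eq[of 2 r] n r r3 by auto
        then have "p n < p 2" using pr p_eq[of n 2] n assms(2) by auto
        moreover have "q \<noteq> n" using calculation q2 by auto
        ultimately show False using av[of n 2 q] q2 q n qr r3 by auto
      qed
      moreover have "r < t"
      proof (rule ccontr)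
        assume "\<not> r < t"
        moreover have "t \<noteq> r" using t r assms by auto
        ultimately have "nx n < nx t" "nx (n - 1) < nx t"
          using drop[of t n] drop[of t "n - 1"] r' t n by auto
        then have "nx n = 1" "nx (n - 1) = 1" using nxn nx_mem[of "n - 1"] n t by auto
        then show False using nx_inj[of n "n - 1"] n by auto
      qed
      ultimately show False using av[of t 2 r] t r n r3 by auto
    qed
    \<comment> \<open>Only source 1 lies to the left of \<open>r = 2\<close>, so it carries the
      largest value other than \<open>n\<close>.\<close>
    have mn: "nx 1 = n - 1"
    proof (rule ccontr)
      assume a: "nx 1 \<noteq> n - 1"
      obtain s where s: "s \<in> {1..n}" "nx s = n - 1" using pred n by blast
      have "s \<noteq> 1" "s \<noteq> 2" using a s r r2 n assms by auto
      then have "nx s < nx 1" using drop[of 1 s] s r2 one_mem by auto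
      then have "nx 1 = n" using s m by auto
      then show False using nx_inj[of 1 r] r r' one_mem by auto
    qed
    \<comment> \<open>Any other last entry \<open>q\<close> gives the 312
      \<open>n - 1, 2, q\<close>.\<close>
    have "q = n"
    proof (rule ccontr)
      assume "q \<noteq> n"
      have "q \<noteq> n - 1" using q m mn assms by auto
      moreover have "p 2 < p q" using q(5)[of 2] n qr r2 by auto
      moreover have "1 < p 2" using m(4)[of 2] n mn r' r2 by auto
      moreover have "q < n - 1" using q(1) calculation(1) \<open>q \<noteq> n\<close> by auto
      ultimately show False using av[of "n - 1" 2 q] q m(2) mn n qr r2 by auto
    qed
    then show ?thesis using m mn q by auto
  qed
qed

text \<open>If 2 is not last, its successor already exceeds \<open>nx 1\<close>, so it must be
  \<open>n\<close>: otherwise the sources \<open>1 < 2 < r\<close> carry a 123. At most one entry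
  can follow this \<open>n\<close>, and if there is one, the word is forced so far that only two
  lengths survive.\<close>

lemma structure_123:
  assumes "c \<in> good (\<lambda>x y z. x < y \<and> y < z) n" "4 \<le> n" and neg: "last c \<noteq> 2"
  shows "(\<exists>d. c = d @ [2, n]) \<or> c = [1, 2, 4, 3] \<or> c = [1, 3, 2, 5, 4]"
proof -
  interpret good_word n c "\<lambda>x y z. x < y \<and> y < z" using assms(1) by unfold_locales
  have n: "2 \<le> n" "2 \<in> {1..n}" "n \<in> {1..n}" "n - 1 \<in> {1..n}" using assms by auto
  note m = nx1[OF n(1)]
  obtain t where t: "t \<in> {1..n}" "nx t = 2" "t \<noteq> 2" "p 2 = p t + 1" using pred2[OF n(1)] by blast
  obtain q where q: "q \<in> {1..n}" "nx q = 1" "last c = q" "p q + 1 = n"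
    "\<And>x. x \<in> {1..n} \<Longrightarrow> x \<noteq> q \<Longrightarrow> p x < p q" using pred1 by blast
  have p2: "0 < p 2" using p_pos[of 2] n by simp
  have y: "nx 2 \<in> {1..n}" "nx 2 \<noteq> 1" "nx 2 \<noteq> 2" "p (nx 2) = p 2 + 1"
    using nx_mem[of 2] nx_neq[of 2] nx_1_iff[of 2] p_last[of 2] p_nx[of 2] neg n by auto
  \<comment> \<open>Otherwise \<open>nx 1, 2, x\<close> is a 312 in the cycle.\<close>
  have after2: "nx 1 < x" if "x \<in> {1..n}" "p 2 < p x" for x
  proof (cases "nx 1 = 2")
    case True
    have "x \<noteq> 1" "x \<noteq> 2" using that p_1 by auto
    then show ?thesis using that True by auto
  next
    case False
    then have "1 < p 2" using m(4)[of 2] n by auto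
    moreover have "x \<noteq> 1" "x \<noteq> 2" "x \<noteq> nx 1" using that p_1 m calculation by auto
    ultimately show ?thesis using av[of "nx 1" 2 x] that m n by fastforce
  qed
  have my: "nx 1 < nx 2" using after2[of "nx 2"] y by auto
  obtain r where r: "r \<in> {1..n}" "nx r = n" using pred n by blast
  have y2: "nx 2 = n"
  proof (rule ccontr)
    assume a: "nx 2 \<noteq> n"
    then have "2 < r" using r my y by (metis atLeastAtMost_iff le_neq_implies_less less_2_cases_iff
      linorder_not_less One_nat_def not_one_le_zero)
    then show False using avR[of 1 2 r] one_mem n r my y a by auto
  qed
  have pn: "p n = p 2 + 1" using y y2 by simp
  show ?thesis
  proof (cases "q = n")
    case True
    then show ?thesis using ends2[of 2 n] n pn q by auto
  next
    case False
    have z: "nx n \<in> {1..n}" "nx n \<noteq> 1" "nx n \<noteq> n" "p (nx n) = p n + 1"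
      using nx_mem[of n] nx_neq[of n] nx_1_iff[of n] p_last[of n] p_nx[of n] n False q by auto
    have mz: "nx 1 < nx n" using after2[of "nx n"] z pn by auto
    \<comment> \<open>With two further entries \<open>?z, ?w\<close> after \<open>n\<close>,
      avoidance of 312 forces \<open>?w < ?z\<close>, and then the sources \<open>1 < ?z < n\<close>
      carry \<open>nx 1 < ?w < ?z\<close>.\<close>
    have zq: "nx n = q"
    proof (rule ccontr)
      assume a: "nx n \<noteq> q"
      let ?z = "nx n" let ?w = "nx (nx n)"
      have "?w \<noteq> 1" using a nx_inj[of ?z q] z q by auto
      then have w: "?w \<in> {1..n}" "p ?w = p ?z + 1" using nx_mem[of ?z] p_nx[of ?z] z by auto
      then have mw: "nx 1 < ?w" using after2[of ?w] z pn by auto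
      have "?w \<noteq> n" using w z by auto
      have "?w < ?z"
      proof (rule ccontr)
        assume "\<not> ?w < ?z"
        moreover have "?w \<noteq> ?z" using w by auto
        ultimately show False using av[of n ?z ?w] w z n \<open>?w \<noteq> n\<close> by auto
      qed
      then show False using avR[of 1 ?z n] one_mem z n mw by auto
    qed
    \<comment> \<open>Otherwise \<open>n - 1\<close> stands before 2, because the cycle ends with
      \<open>2, n, nx n\<close>, and \<open>n - 1, 2, nx n\<close> is a 312.\<close>
    have z1: "nx n = n - 1"
    proof (rule ccontr)
      assume a: "nx n \<noteq> n - 1"
      have "p (n - 1) < p q" using q(5)[of "n - 1"] n a zq by auto
      moreover have "p (n - 1) \<noteq> p 2" "p (n - 1) \<noteq> p n" using p_eq[of "n - 1"] n assms(2) by auto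
      ultimately have "p (n - 1) < p 2" using zq z pn by auto
      moreover have "nx n < n - 1" using z(1,3) a by auto
      moreover have "2 < nx n" using mz m(1) by auto
      ultimately show False using av[of "n - 1" 2 "nx n"] n z(1,4) pn by auto
    qed
    have m2: "nx 1 = n - 2"
    proof (rule ccontr)
      assume a: "nx 1 \<noteq> n - 2"
      have "n - 2 \<in> {1..n}" unfolding atLeastAtMost_iff using assms(2) by linarith
      then obtain s where s: "s \<in> {1..n}" "nx s = n - 2" using pred by blast
      have "n - 1 \<noteq> n - 2" using assms(2) by linarith
      then have "s \<noteq> 1" "s \<noteq> n" using a z1 s by auto
      then have "1 < s" "s < n" using s by auto
      moreover have "nx 1 < n - 2" "n - 2 < n - 1" using mz z1 a assms(2) by linarith+
      ultimately show False using avR[of 1 s n] s n one_mem z1 by auto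
    qed
    \<comment> \<open>For \<open>n \<ge> 6\<close> the value 3 is below \<open>nx 1 = n - 2\<close>,
      which first places 3 before 2 in the cycle and then forces \<open>t = 3\<close>: otherwise
      \<open>nx 1, 3, t\<close> is a 312. The sources \<open>3 < s < n\<close> now carry
      \<open>2, 3, n - 1\<close>, a 123.\<close>
    have "n \<le> 5"
    proof (rule ccontr)
      assume "\<not> n \<le> 5"
      then have n6: "6 \<le> n" by simp
      have m2': "1 < p 2" using m(4)[of 2] n n6 m2 by auto
      have t': "t \<noteq> 1" "t \<noteq> n" "t \<noteq> n - 1" using t m2 z1 n6 zq q by auto
      have three: "3 \<in> {1..n}" using n6 by auto
      have m4: "3 < nx 1" using m2 n6 by linarith
      have t3: "t = 3"
      proof (rule ccontr)
        assume a: "t \<noteq> 3"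
        have "\<not> p 2 < p 3" using av[of "nx 1" 2 3] n three m(1,2) m2' m4 by auto
        then have "p 3 < p 2" using p_eq[of 2 3] n three by auto
        then have p3: "p 3 < p t" using p_eq[of 3 t] t three a by auto
        moreover have pm: "p (nx 1) < p 3" using m(2) m(4)[of 3] three m4 by auto
        ultimately have "t \<noteq> nx 1" by auto
        then have "t < nx 1" using t' t(1) m2 unfolding atLeastAtMost_iff by linarith
        moreover have "3 < t" using t t' a by auto
        ultimately show False using av[of "nx 1" 3 t] t m(1) three pm p3 by auto
      qed
      obtain s where s: "s \<in> {1..n}" "nx s = 3" using pred[OF three] by blast
      have z3: "3 < nx n" using z1 n6 by linarith
      have "s \<noteq> 1" "s \<noteq> 2" "s \<noteq> 3" "s \<noteq> n" using s m4 y2 z3 n6 t t3 by auto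
      then show False using avR[of 3 s n] s n three z3 t t3 by auto
    qed
    have pn3: "p 2 + 3 = n" using q z pn zq by auto
    have nth: "c ! p 2 = 2" "c ! (p 2 + 1) = n" "c ! (p 2 + 2) = n - 1"
      using nth_p[of 2] nth_p[of n] nth_p[of "nx n"] n z z1 pn by auto
    from \<open>n \<le> 5\<close> assms(2) consider "n = 4" | "n = 5" by linarith
    then show ?thesis
    proof cases
      case 1
      then have "p 2 = 1" using pn3 by simp
      then have "c = [1, 2, 4, 3]" using c_0 nth len 1
        by (intro nth_equalityI) (auto simp: less_Suc_eq numeral_eq_Suc)
      then show ?thesis by simp
    next
      case 2
      then have "p 2 = 2" using pn3 by simp
      then have "c = [1, 3, 2, 5, 4]" using c_0 nth len 2 m m2
        by (intro nth_equalityI) (auto simp: less_Suc_eq numeral_eq_Suc)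
      then show ?thesis by simp
    qed
  qed
qed

text \<open>Both uses concern words that end with 2, so source 2 has no edge inside the word. Its
  edge in the full cycle supplies the missing value of a pattern: with target 1 an ascent at sources
  from 3 on would complete a 123, and with a target beyond the word a 312. Source 1 lies to the left
  of 2 and is left free.\<close>

definition descending :: "nat list \<Rightarrow> bool" where
  "descending u \<longleftrightarrow> (\<forall>i a j b. (i, a) \<in> steps u \<and> (j, b) \<in> steps u \<and> 3 \<le> i \<and> i < j \<longrightarrow> b < a)"

lemma initial_segment:
  fixes A B :: "nat set"
  assumes "A \<union> B = {1..n}" "\<And>a b. a \<in> A \<Longrightarrow> b \<in> B \<Longrightarrow> a < b" "A \<noteq> {}"
  shows "A = {1..card A}"
proof -
  have fin: "finite A" using assms(1) by (metis finite_Un finite_atLeastAtMost)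
  have "A = {1..Max A}"
  proof (intro equalityI subsetI)
    fix x assume "x \<in> A"
    then show "x \<in> {1..Max A}" using fin assms(1) by (metis Max_ge UnI1 atLeastAtMost_iff)
  next
    fix x assume x: "x \<in> {1..Max A}"
    have M: "Max A \<in> A" using fin assms(3) by simp
    then have "Max A \<in> {1..n}" using assms(1) by blast
    then have "x \<in> A \<union> B" using x assms(1) by auto
    then show "x \<in> A" using assms(2)[OF M, of x] x by auto
  qed
  then show ?thesis by (metis card_atLeastAtMost diff_Suc_1)
qed

text \<open>Cut the cycle right after 2. Labels before the cut are smaller than those after it,
  since otherwise some \<open>x, 2, z\<close> is a 312; so the first block consists of an initial
  segment of labels.\<close>

lemma structure_312:
  assumes "c \<in> good (\<lambda>x y z. y < z \<and> z < x) n" "3 \<le> n" and neg: "c ! 1 \<noteq> 2"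
  obtains u v where "c = u @ v" "3 \<le> length u" "v \<noteq> []" "last u = 2" "set u = {1..length u}"
    "hd v = length u + 1" "descending u"
proof -
  interpret good_word n c "\<lambda>x y z. y < z \<and> z < x" using assms(1) by unfold_locales
  have n: "2 \<le> n" "2 \<in> {1..n}" "n \<in> {1..n}" "n - 1 \<in> {1..n}" using assms by auto
  note m = nx1[OF n(1)]
  obtain t where t: "t \<in> {1..n}" "nx t = 2" "t \<noteq> 2" "p 2 = p t + 1" using pred2[OF n(1)] by blast
  have m3: "2 < nx 1" using neg m by auto
  have t2: "2 < t" using t m3 by (metis One_nat_def Suc_1 Suc_leI atLeastAtMost_iff le_neq_implies_less less_irrefl)
  have m2: "1 < p 2" using m(4)[of 2] n m3 by auto
  \<comment> \<open>If 2 were last, the sources \<open>1 < 2 < t\<close> would carry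
    \<open>nx 1, 1, 2\<close>, a 312. So the second block is not empty.\<close>
  have "nx 2 \<noteq> 1"
  proof
    assume "nx 2 = 1"
    then show False using avR[of 1 2 t] t t2 m3 n one_mem by auto
  qed
  then have y: "nx 2 \<in> {1..n}" "p (nx 2) = p 2 + 1" using nx_mem[of 2] p_nx[of 2] n by auto
  define k where "k = p 2 + 1"
  define u where "u = take k c"
  define v where "v = drop k c"
  have kn: "k < n" using y p_less[of "nx 2"] k_def by auto
  have uv: "c = u @ v" "length u = k" "length v = n - k" using kn len by (auto simp: u_def v_def)
  have ne: "u \<noteq> []" "v \<noteq> []" using kn uv k_def by auto
  have in_u: "x \<in> set u \<longleftrightarrow> x \<in> {1..n} \<and> p x < k" for x
  proof
    assume "x \<in> set u"
    then obtain i where "i < k" "c ! i = x" using kn len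
      by (metis in_set_conv_nth nth_take u_def uv(2))
    then show "x \<in> {1..n} \<and> p x < k" using p_nth[of i] nth_mem[of i] kn by auto
  next
    assume "x \<in> {1..n} \<and> p x < k"
    then have "u ! p x = x" "p x < length u" using nth_p[of x] uv(2) by (auto simp: u_def)
    then show "x \<in> set u" by (metis List.nth_mem)
  qed
  have in_v: "x \<in> set v \<longleftrightarrow> x \<in> {1..n} \<and> k \<le> p x" for x
    using in_u[of x] distinct set_c uv(1) by (auto simp: not_less)
  have less: "a < b" if "a \<in> set u" "b \<in> set v" for a b
  proof (cases "p a = 0 \<or> a = 2")
    case True
    then have "a = 1 \<or> a = 2" using p_pos[of a] that(1) in_u[of a] by (metis less_irrefl)
    moreover have "b \<noteq> 1" "b \<noteq> 2" using that in_v k_def p_1 by auto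
    moreover have "b \<in> {1..n}" using that in_v by auto
    ultimately show ?thesis unfolding atLeastAtMost_iff by linarith
  next
    case False
    have an: "a \<in> {1..n}" "p a < k" and bn: "b \<in> {1..n}" "k \<le> p b" using that in_u in_v by auto
    have a1: "a \<noteq> 1" "a \<noteq> 2" using False p_1 by metis+
    have a2: "2 < a" using an(1) a1 unfolding atLeastAtMost_iff by linarith
    have "p a \<noteq> p 2" using p_eq an(1) n(2) a1(2) by simp
    then have pa: "p a < p 2" using an(2) k_def by linarith
    have pb: "p 2 < p b" using bn(2) k_def by linarith
    then have "b \<noteq> 1" "b \<noteq> 2" using p_1 by (metis not_less_zero, blast)
    then have b2: "2 < b" using bn(1) unfolding atLeastAtMost_iff by linarith
    have "a \<noteq> b" using an bn by auto
    moreover have "\<not> b < a" using av[of a 2 b] an bn n pa pb b2 by blast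
    ultimately show ?thesis by linarith
  qed
  have "set u \<union> set v = {1..n}" using set_c uv by auto
  then have set_u: "set u = {1..k}"
    using initial_segment[of "set u" "set v" n] less ne distinct uv
    by (metis distinct_append distinct_card set_empty)
  have last_u: "last u = 2" using ne nth_p[of 2] n kn len
    by (simp add: last_conv_nth u_def k_def)
  have hd_v: "hd v = nx 2" using ne kn len y nth_p[of "nx 2"]
    by (simp add: v_def hd_drop_conv_nth k_def)
  have yk: "k < nx 2"
  proof (rule less)
    show "k \<in> set u" using set_u k_def by simp
    show "nx 2 \<in> set v" using hd_v ne(2) by (metis list.set_sel(1))
  qed
  \<comment> \<open>Otherwise \<open>k + 1\<close> has its predecessor \<open>x\<close> in the
    second block, which gives \<open>t < x\<close>, and the sources \<open>2 < t < x\<close> carry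
    \<open>nx 2, 2, k + 1\<close>.\<close>
  have "nx 2 = k + 1"
  proof (rule ccontr)
    assume a: "nx 2 \<noteq> k + 1"
    have k1: "k + 1 \<in> {1..n}" using yk y by auto
    then have "k + 1 \<in> set v" using in_u[of "k + 1"] in_v set_u by auto
    then have "k \<le> p (k + 1)" using in_v by auto
    moreover have "p (k + 1) \<noteq> k" using p_eq[of "k + 1" "nx 2"] y k1 a k_def by auto
    ultimately have pk: "k < p (k + 1)" by simp
    obtain x where x: "x \<in> {1..n}" "nx x = k + 1" using pred[OF k1] by blast
    then have "p (k + 1) = p x + 1" using p_nx[of x] k_def by auto
    then have "x \<in> set v" using in_v x pk by auto
    moreover have "t \<in> set u" using in_u t k_def by auto
    ultimately have "t < x" using less by blast
    then show False using avR[of 2 t x] n t t2 x yk a m2 k_def by auto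
  qed
  \<comment> \<open>The value at source 2 exceeds \<open>k\<close>, so an ascent at two larger
    sources inside the block would complete a 312.\<close>
  moreover have "descending u"
    unfolding descending_def
  proof (intro allI impI)
    fix i a j b assume h: "(i, a) \<in> steps u \<and> (j, b) \<in> steps u \<and> 3 \<le> i \<and> i < j"
    have "steps u \<subseteq> steps c" unfolding uv(1) using ne by (simp add: steps_append) blast
    then have nx: "a = nx i" "b = nx j" "i \<in> {1..n}" "j \<in> {1..n}" using h unfolding steps_c by auto
    have "set (tl u) \<subseteq> set u" by (cases u) auto
    then have "a \<le> k" "b \<le> k" using h steps_subset[of u] set_u by auto
    moreover have "a \<noteq> b" using nx h nx_inj[of i j] by auto
    moreover have "\<not> nx i < nx j"
      using avR[of 2 i j] n nx(3,4) h yk calculation(2) unfolding nx(2) by auto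
    ultimately show "b < a" using nx(1,2) by linarith
  qed
  ultimately show ?thesis using that[of u v] uv ne last_u set_u hd_v k_def m2 by auto
qed

subsection \<open>Building words\<close>

lemma avoids_iff:
  "avoids R E \<longleftrightarrow> (\<forall>u\<in>E. \<forall>v\<in>E. \<forall>w\<in>E. fst u < fst v \<longrightarrow> fst v < fst w \<longrightarrow> \<not> R (snd u) (snd v) (snd w))"
  unfolding avoids_def by (metis fst_conv prod.collapse snd_conv)

text \<open>Only the order of the sources and the pattern of the targets matter, so the two
  coordinates may be moved independently.\<close>

lemma avoids_map_prod:
  assumes "strict_mono f" "\<And>a b d. R (g a) (g b) (g d) \<longleftrightarrow> R a b d"
  shows "avoids R (map_prod f g ` E) \<longleftrightarrow> avoids R E"
  unfolding avoids_iff using assms by (simp add: strict_mono_less)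

lemma avoids_subset: "avoids R E \<Longrightarrow> F \<subseteq> E \<Longrightarrow> avoids R F"
  unfolding avoids_iff by blast

text \<open>Opens a gap of \<open>k\<close> labels right above 1. On sources, with
  \<open>k = 1\<close>, it makes room for a new entry 2; on targets it lifts everything over an
  inserted first block, except the target 1 of the closing edge.\<close>

definition spread :: "nat \<Rightarrow> nat \<Rightarrow> nat" where
  "spread k x = (if x \<le> 1 then x else x + k)"

lemma strict_mono_spread: "strict_mono (spread k)"
  by (auto simp: strict_mono_def spread_def)

lemma spread_less_iff [simp]: "spread k x < spread k y \<longleftrightarrow> x < y"
  using strict_mono_spread by (rule strict_mono_less)

text \<open>
  Appending a list that begins with 2 to \<open>lift c\<close> relabels the edges of \<open>c\<close>
  by increasing maps: the sources by \<open>spread 1\<close> and the targets by \<open>Suc\<close>, because the edge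
  \<open>(last c, 1)\<close> turns into \<open>(spread 1 (last c), 2)\<close>.
\<close>

definition lift :: "nat list \<Rightarrow> nat list" where
  "lift c = 1 # map Suc (tl c)"

definition glue :: "nat list \<Rightarrow> nat list \<Rightarrow> nat list" where
  "glue u c = u @ map (\<lambda>x. x + length u) c"

lemma words_tl:
  assumes "c \<in> words n"
  shows "c = 1 # tl c" "distinct (tl c)" "set (tl c) = {2..n}"
proof -
  show c: "c = 1 # tl c" using assms by (cases c) (auto simp: words_def)
  then have d: "distinct (1 # tl c)" "set (1 # tl c) = {1..n}" using assms by (auto simp: words_def)
  then show "distinct (tl c)" by simp
  show "set (tl c) = {2..n}"
  proof (intro equalityI subsetI)
    fix x assume "x \<in> set (tl c)"
    then have "x \<noteq> 1" "x \<in> {1..n}" using d by auto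
    then show "x \<in> {2..n}" by auto
  next
    fix x assume "x \<in> {2..n}"
    then have "x \<noteq> 1" "x \<in> set (1 # tl c)" unfolding d(2) by auto
    then show "x \<in> set (tl c)" by simp
  qed
qed

lemma wordsI: "distinct e \<Longrightarrow> set e = {2..n} \<Longrightarrow> 1 \<le> n \<Longrightarrow> 1 # e \<in> words n"
  by (auto simp: words_def)

lemma words_pos: "c \<in> words n \<Longrightarrow> 1 \<le> n"
  using words_length[of c n] by (cases c) (auto simp: words_def)

lemma words_last: "c \<in> words n \<Longrightarrow> last c \<in> {1..n}"
  by (metis (mono_tags, lifting) last_in_set mem_Collect_eq words_def)

lemma lift_eq_map: "c \<in> words n \<Longrightarrow> lift c = map (spread 1) c"
proof -
  assume c: "c \<in> words n"
  have "map (spread 1) (1 # tl c) = lift c"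
    using words_tl(3)[OF c] by (auto simp: lift_def spread_def)
  then show ?thesis using words_tl(1)[OF c] by metis
qed

lemma set_lift: "c \<in> words n \<Longrightarrow> set (lift c) = insert 1 {3..n + 1}"
proof -
  assume c: "c \<in> words n"
  have "Suc ` {2..n} = {3..n + 1}" by (simp add: image_Suc_atLeastAtMost numeral_eq_Suc)
  then show ?thesis using words_tl[OF c] by (simp add: lift_def)
qed

lemma distinct_lift: "c \<in> words n \<Longrightarrow> distinct (lift c)"
  using words_tl[of c n] by (auto simp: lift_def distinct_map)

lemma last_lift: "c \<in> words n \<Longrightarrow> last (lift c) = spread 1 (last c)"
  using words_tl(1)[of c n] by (metis lift_eq_map last_map list.distinct(1))

lemma inj_on_lift: "inj_on lift (words n)"
proof (rule inj_onI)
  fix c d assume *: "c \<in> words n" "d \<in> words n" "lift c = lift d"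
  then have "tl c = tl d" by (auto simp: lift_def dest: injD[OF inj_mapI[OF inj_Suc]])
  then show "c = d" using words_tl(1)[OF *(1)] words_tl(1)[OF *(2)] by simp
qed

text \<open>Stated for a general \<open>N\<close> and list \<open>ys\<close> to serve the endings
  \<open>[2]\<close>, \<open>[2, n + 2]\<close> and \<open>[n + 2, 2]\<close> at once; for
  \<open>N = n + 1\<close> the interval of new large labels is empty.\<close>

lemma words_lift:
  assumes "c \<in> words n" "distinct ys" "set ys = insert 2 {n + 2..N}" "n + 1 \<le> N"
  shows "lift c @ ys \<in> words N"
proof -
  have "insert 1 {3..n + 1} \<union> insert 2 {n + 2..N} = {1..N}"
    using words_pos[OF assms(1)] assms(4) by auto
  moreover have "insert 1 {3..n + 1} \<inter> insert 2 {n + 2..N} = {}" by auto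
  ultimately have "distinct (lift c @ ys)" "set (lift c @ ys) = {1..N}"
    unfolding distinct_append set_append set_lift[OF assms(1)] assms(3)
    using assms(2) distinct_lift[OF assms(1)] by blast+
  then show ?thesis unfolding words_def by (simp add: lift_def)
qed

lemma words_liftE:
  assumes w: "d @ ys \<in> words N" and ys: "set ys = insert 2 {n + 2..N}" and n: "1 \<le> n" "n + 1 \<le> N"
  obtains c where "c \<in> words n" "d = lift c"
proof -
  have dist: "distinct (d @ ys)" and set: "set d \<union> set ys = {1..N}" and disj: "set d \<inter> set ys = {}"
    and hd: "hd (d @ ys) = 1"
    using w by (auto simp: words_def)
  have set_d: "set d = insert 1 {3..n + 1}"
  proof -
    have "set d = {1..N} - set ys" using set disj by blast
    also have "\<dots> = insert 1 {3..n + 1}" unfolding ys using n by auto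
    finally show ?thesis .
  qed
  then obtain e where d: "d = 1 # e" using hd by (cases d) auto
  then have e: "distinct e" "1 \<notin> set e" using dist by auto
  have "insert 1 (set e) = insert 1 {3..n + 1}" using set_d d by simp
  moreover have "1 \<notin> {3..n + 1}" by simp
  ultimately have set_e: "set e = {3..n + 1}" using e(2) by (metis insert_ident)
  let ?e = "map (\<lambda>x. x - 1) e"
  have "map Suc ?e = map id e" unfolding map_map by (rule map_cong) (auto simp: set_e)
  then have me: "map Suc ?e = e" by simp
  have "set (map Suc ?e) = Suc ` {2..n}" unfolding me set_e by (simp add: image_Suc_atLeastAtMost numeral_eq_Suc)
  then have "Suc ` set ?e = Suc ` {2..n}" unfolding set_map .
  then have "set ?e = {2..n}" by (simp only: inj_image_eq_iff[OF inj_Suc])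
  moreover have "distinct ?e" using e(1) me by (metis distinct_map)
  ultimately have "1 # ?e \<in> words n" using n by (intro wordsI)
  moreover have "d = lift (1 # ?e)" using d me by (simp add: lift_def)
  ultimately show ?thesis using that by blast
qed

text \<open>No step inside a word leads back to 1, and on targets from 2 on \<open>spread 1\<close>
  is the successor map.\<close>

lemma steps_lift: "c \<in> words n \<Longrightarrow> steps (lift c) = map_prod (spread 1) Suc ` steps c"
proof -
  assume c: "c \<in> words n"
  have "snd e \<ge> 2" if "e \<in> steps c" for e
    using steps_subset[of c] words_tl(3)[OF c] that by auto
  then have "map_prod (spread 1) (spread 1) e = map_prod (spread 1) Suc e" if "e \<in> steps c" for e
    using that by (cases e) (force simp: spread_def)
  then show ?thesis unfolding lift_eq_map[OF c] steps_map by (rule image_cong[OF refl])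
qed

lemma cyc_word: "c \<in> words n \<Longrightarrow> cyc c = insert (last c, 1) (steps c)"
  by (auto simp: cyc_def words_def)

lemma cyc_lift:
  assumes "c \<in> words n"
  shows "cyc (lift c @ 2 # ys) = map_prod (spread 1) Suc ` cyc c \<union> insert (last (2 # ys), 1) (steps (2 # ys))"
proof -
  have "lift c \<noteq> []" "hd (lift c) = 1" by (auto simp: lift_def)
  moreover have "(spread 1 (last c), 2) = map_prod (spread 1) Suc (last c, 1)" by simp
  ultimately show ?thesis
    unfolding cyc_word[OF assms] unfolding cyc_def
    using assms by (auto simp: steps_append steps_lift last_lift)
qed

lemma cyc_word_bounds: "c \<in> words n \<Longrightarrow> e \<in> cyc c \<Longrightarrow> fst e \<in> {1..n} \<and> snd e \<in> {1..n}"
proof -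
  assume c: "c \<in> words n" and e: "e \<in> cyc c"
  have "steps c \<subseteq> {1..n} \<times> {1..n}"
    using steps_subset[of c] words_tl(3)[OF c] c by (auto simp: words_def)
  then show ?thesis using e words_last[OF c] words_pos[OF c] by (auto simp: cyc_word[OF c])
qed

lemma av312_append:
  "av312 (xs @ ys) \<longleftrightarrow> av312 xs \<and> av312 ys \<and>
     (\<forall>x y z. subseq [x, y] xs \<and> z \<in> set ys \<longrightarrow> \<not> (y < z \<and> z < x)) \<and>
     (\<forall>x y z. x \<in> set xs \<and> subseq [y, z] ys \<longrightarrow> \<not> (y < z \<and> z < x))"
  unfolding av312_def subseq3_append by blast

lemma av312_map:
  assumes "\<And>x y. f x < f y \<longleftrightarrow> (x :: nat) < y"
  shows "av312 (map f c) \<longleftrightarrow> av312 c"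
  unfolding av312_def subseq3_map using assms by blast

lemma av312_short [simp]: "av312 []" "av312 [x]" "av312 [x, y]"
  by (auto simp: av312_def subseq3_Cons subseq2_Cons simp del: subseq_Cons2_iff)

lemma av312_lift: "c \<in> words n \<Longrightarrow> av312 (lift c) \<longleftrightarrow> av312 c"
  by (simp add: lift_eq_map av312_map)

lemma subseq2_lift: "subseq [x, y] (lift c) \<Longrightarrow> c \<in> words n \<Longrightarrow> 3 \<le> y \<and> x \<noteq> 0"
proof -
  assume s: "subseq [x, y] (lift c)" and c: "c \<in> words n"
  have "set (map Suc (tl c)) = Suc ` {2..n}" using words_tl(3)[OF c] by simp
  then have "y \<in> Suc ` {2..n}" using s unfolding lift_def subseq2_Cons by (metis subseq2_set)
  moreover have "x \<in> set (lift c)" using s by (auto dest: subseq2_set)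
  ultimately show ?thesis using set_lift[OF c] by auto
qed

text \<open>A third entry taken from \<open>ys\<close> is either 2, too small to exceed an entry
  from 3 on, or at least \<open>n + 2\<close>, too large to stay below the first one. If the last
  two entries come from \<open>ys\<close>, the ascent ends above every label of
  \<open>lift c\<close>.\<close>

lemma av312_lift_append:
  assumes c: "c \<in> words n" and ys: "av312 ys" "\<And>y z. subseq [y, z] ys \<Longrightarrow> y < z \<Longrightarrow> n + 1 < z"
    "set ys \<subseteq> insert 2 {n + 2..}"
  shows "av312 (lift c @ ys) \<longleftrightarrow> av312 c"
proof -
  have "\<not> (y < z \<and> z < x)" if "subseq [x, y] (lift c)" "z \<in> set ys" for x y z
  proof -
    have "3 \<le> y" using subseq2_lift[OF that(1) c] by simp
    moreover have "x \<le> n + 1" using subseq2_set[OF that(1)] set_lift[OF c] words_pos[OF c] by auto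
    ultimately show ?thesis using ys(3) that(2) by auto
  qed
  moreover have "\<not> (y < z \<and> z < x)" if "x \<in> set (lift c)" "subseq [y, z] ys" for x y z
  proof -
    have "x \<le> n + 1" using that(1) set_lift[OF c] words_pos[OF c] by auto
    then show ?thesis using ys(2)[OF that(2)] by auto
  qed
  ultimately show ?thesis using ys(1) av312_lift[OF c] unfolding av312_append by blast
qed

lemma words_glue:
  assumes u: "u \<in> words k" and c: "c \<in> words n"
  shows "glue u c \<in> words (k + n)"
proof -
  have l: "length u = k" by (rule words_length[OF u])
  have "(\<lambda>x. x + k) ` {1..n} = {k + 1..k + n}"
    by (simp add: image_add_atLeastAtMost' add.commute)
  then have "set (map (\<lambda>x. x + k) c) = {k + 1..k + n}" using c by (auto simp: words_def)
  moreover have "distinct (map (\<lambda>x. x + k) c)" using c by (simp add: words_def distinct_map)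
  moreover have "{1..k} \<union> {k + 1..k + n} = {1..k + n}" by auto
  moreover have "{1..k} \<inter> {k + 1..k + n} = {}" by auto
  ultimately show ?thesis using u unfolding glue_def l words_def by simp
qed

lemma words_glueE:
  assumes w: "u @ v \<in> words N" and u: "set u = {1..length u}" "u \<noteq> []" and v: "v \<noteq> []" "hd v = length u + 1"
  obtains c where "u \<in> words (length u)" "c \<in> words (N - length u)" "u @ v = glue u c" "length u < N"
proof -
  let ?k = "length u"
  have dist: "distinct u" "distinct v" and set: "set u \<union> set v = {1..N}" and disj: "set u \<inter> set v = {}"
    and hd: "hd (u @ v) = 1"
    using w by (auto simp: words_def)
  have uw: "u \<in> words ?k" using dist u hd by (simp add: words_def)
  have "?k + 1 \<in> set v" using v by (metis list.set_sel(1))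
  then have kN: "?k < N" using set by (metis UnCI Suc_eq_plus1 Suc_le_eq atLeastAtMost_iff)
  have set_v: "set v = {?k + 1..N}"
  proof -
    have "set v = {1..N} - set u" using set disj by blast
    also have "\<dots> = {?k + 1..N}" unfolding u(1) by auto
    finally show ?thesis .
  qed
  let ?c = "map (\<lambda>x. x - ?k) v"
  have "map (\<lambda>x. x + ?k) ?c = map id v" unfolding map_map by (rule map_cong) (auto simp: set_v)
  then have mc: "map (\<lambda>x. x + ?k) ?c = v" by simp
  have "set ?c = {1..N - ?k}"
  proof -
    have "(\<lambda>x. x + ?k) ` set ?c = (\<lambda>x. x + ?k) ` {1..N - ?k}"
      using mc set_v kN by (metis (no_types, lifting) add.commute image_add_atLeastAtMost' image_cong
          le_add_diff_inverse less_imp_le list.set_map)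
    moreover have "inj (\<lambda>x. x + ?k)" by simp
    ultimately show ?thesis by (metis inj_image_eq_iff)
  qed
  moreover have "distinct ?c" using dist mc by (metis distinct_map)
  moreover have "hd ?c = 1" using v by (simp add: hd_map)
  ultimately have "?c \<in> words (N - ?k)" using v by (simp add: words_def)
  moreover have "u @ v = glue u ?c" using mc by (simp add: glue_def)
  ultimately show ?thesis using that uw kN by blast
qed

lemma inj_glue: "inj (glue u)"
  unfolding glue_def by (rule injI, drule same_append_eq[THEN iffD1], erule map_injective) simp

text \<open>The closing edge of \<open>c\<close> becomes the closing edge of the whole word and
  keeps its target 1. All other targets in \<open>c\<close> are at least 2 and move up with the
  entries, hence \<open>spread k\<close> on targets against a plain shift on sources.\<close>

lemma cyc_glue:
  assumes u: "u \<in> words k" and c: "c \<in> words n"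
  shows "cyc (glue u c) = steps u \<union> insert (last u, k + 1) (map_prod (\<lambda>x. x + k) (spread k) ` cyc c)"
proof -
  have l: "length u = k" by (rule words_length[OF u])
  have ne: "u \<noteq> []" "c \<noteq> []" "hd u = 1" "hd c = 1" using u c by (auto simp: words_def)
  have "snd e \<ge> 2" if "e \<in> steps c" for e
    using steps_subset[of c] words_tl(3)[OF c] that by auto
  then have "map_prod (\<lambda>x. x + k) (\<lambda>x. x + k) e = map_prod (\<lambda>x. x + k) (spread k) e" if "e \<in> steps c" for e
    using that by (cases e) (force simp: spread_def)
  then have "steps (map (\<lambda>x. x + k) c) = map_prod (\<lambda>x. x + k) (spread k) ` steps c"
    unfolding steps_map by (rule image_cong[OF refl])
  moreover have "spread k 1 = 1" by (simp add: spread_def)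
  ultimately show ?thesis
    unfolding cyc_word[OF c] unfolding cyc_def glue_def l
    using ne by (simp add: steps_append last_map hd_map insert_commute)
qed

text \<open>Every entry of the second block exceeds every entry of the first, so no 312 can meet
  both.\<close>

lemma av312_glue:
  assumes u: "u \<in> words k" and c: "c \<in> words n"
  shows "av312 (glue u c) \<longleftrightarrow> av312 u \<and> av312 c"
proof -
  have l: "length u = k" by (rule words_length[OF u])
  have "x < z" if "x \<in> set u" "z \<in> set (map (\<lambda>x. x + k) c)" for x z
    using that u c by (auto simp: words_def)
  then show ?thesis unfolding glue_def av312_append l
    by (subst av312_map) (auto dest!: subseq2_set dest: order.asym)
qed

section \<open>Short words, and adding one or two entries at an end\<close>

lemma words_1: "words (Suc 0) = {[Suc 0]}"
proof -
  have "c = [Suc 0]" if "c \<in> words (Suc 0)" for c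
    using words_tl(1)[OF that] words_length[OF that] by (cases c) auto
  moreover have "[Suc 0] \<in> words (Suc 0)" by (auto simp: words_def)
  ultimately show ?thesis by blast
qed

lemma words_2: "words 2 = {[1, 2]}"
proof -
  have "c = [1, 2]" if "c \<in> words 2" for c
    using words_tl[OF that] words_length[OF that] by (cases c; cases "tl c") auto
  moreover have "[1, 2] \<in> words 2" by (auto simp: words_def)
  ultimately show ?thesis by blast
qed

lemma words_3: "words 3 = {[1, 2, 3], [1, 3, 2]}"
proof -
  have "c = [1, 2, 3] \<or> c = [1, 3, 2]" if c: "c \<in> words 3" for c
  proof -
    obtain a b where "c = [1, a, b]"
      using words_tl(1)[OF c] words_length[OF c] by (auto simp: numeral_3_eq_3 length_Suc_conv)
    moreover from this have "a \<noteq> b" "{a, b} = {2..3}" using words_tl(2,3)[OF c] by auto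
    moreover have "{2..3::nat} = {2, 3}" by auto
    ultimately show ?thesis by (auto simp: doubleton_eq_iff)
  qed
  moreover have "[1, 2, 3] \<in> words 3" "[1, 3, 2] \<in> words 3" by (auto simp: words_def)
  ultimately show ?thesis by blast
qed

lemma good_1: "good R 1 = {[1]}"
  by (auto simp: good_def words_1 avoids_iff cyc_def)

lemma good_2: "good R 2 = {[1, 2]}"
  unfolding good_def words_2 by (auto simp: avoids_iff cyc_def)

lemma words_nth_1: "c \<in> words n \<Longrightarrow> 2 \<le> n \<Longrightarrow> c ! 1 \<in> {2..n}"
  using words_tl[of c n] words_length[of c n]
  by (metis One_nat_def Suc_le_lessD diff_Suc_1 length_tl nth_Cons_Suc nth_mem numeral_2_eq_2 zero_less_diff)

lemma lift_nth_1: "c \<in> words n \<Longrightarrow> 2 \<le> n \<Longrightarrow> (lift c @ ys) ! 1 \<ge> 3"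
  using words_nth_1[of c n] words_length[of c n] by (simp add: lift_eq_map nth_append spread_def)

lemma glue_1_nth_1: "c \<in> words n \<Longrightarrow> glue [Suc 0] c ! 1 = 2"
  using words_tl(1)[of c n] by (cases c) (auto simp: glue_def)

lemma words_nth_1_eq_2E:
  assumes "w \<in> words (Suc n)" "1 \<le> n" "w ! 1 = 2"
  obtains c where "c \<in> words n" "w = glue [Suc 0] c"
proof -
  have w: "w = [1] @ tl w" "tl w \<noteq> []" using words_tl(1)[OF assms(1)] words_length[OF assms(1)] assms(2)
    by (auto simp: tl_Nil)
  then have "hd (tl w) = 2" using assms(3) by (metis append_Cons append_Nil hd_conv_nth nth_Cons_Suc One_nat_def)
  then obtain c where "c \<in> words (Suc n - length [1::nat])" "[1] @ tl w = glue [1] c"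
    using words_glueE[of "[1]" "tl w" "Suc n"] w assms(1) by auto
  then show ?thesis using that w by simp
qed

lemma cyc_glue_1:
  assumes "c \<in> words n"
  shows "cyc (glue [Suc 0] c) = insert (1, 2) (map_prod Suc (spread 1) ` cyc c)"
proof -
  have "[Suc 0] \<in> words 1" by (simp add: words_1)
  then show ?thesis using cyc_glue[of "[Suc 0]" 1 c n] assms by (simp add: numeral_2_eq_2)
qed

lemma words_glue_1: "c \<in> words n \<Longrightarrow> glue [Suc 0] c \<in> words (Suc n)"
  using words_glue[of "[Suc 0]" 1 c n] by (simp add: words_1)

lemma av312_glue_1: "c \<in> words n \<Longrightarrow> av312 (glue [Suc 0] c) \<longleftrightarrow> av312 c"
  using av312_glue[of "[Suc 0]" 1 c n] by (simp add: words_1)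

lemma words_last_2E:
  assumes "w \<in> words (Suc n)" "1 \<le> n" "last w = 2"
  obtains c where "c \<in> words n" "w = lift c @ [2]"
proof -
  have "w \<noteq> []" using assms by (auto simp: words_def)
  then have w: "butlast w @ [2] \<in> words (Suc n)" "w = butlast w @ [2]"
    using assms by (metis append_butlast_last_id)+
  obtain c where "c \<in> words n" "butlast w = lift c"
    by (rule words_liftE[OF w(1), of n]) (use assms in auto)
  then show ?thesis using that w by metis
qed

lemma words_lift_2: "c \<in> words n \<Longrightarrow> lift c @ [2] \<in> words (Suc n)"
  by (rule words_lift) auto

lemma cyc_lift_2:
  assumes "c \<in> words n"
  shows "cyc (lift c @ [2]) = insert (2, 1) (map_prod (spread 1) Suc ` cyc c)"
  using cyc_lift[OF assms, of "[]"] by simp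

lemma av312_lift_2: "c \<in> words n \<Longrightarrow> av312 (lift c @ [2]) \<longleftrightarrow> av312 c"
  by (rule av312_lift_append) (auto simp: subseq2_Cons simp del: subseq_Cons2_iff)

lemma words_lift_2_max: "c \<in> words n \<Longrightarrow> lift c @ [2, n + 2] \<in> words (n + 2)"
  by (rule words_lift) (auto dest: words_pos)

lemma words_ends_2_maxE:
  assumes "w \<in> words (n + 2)" "1 \<le> n" "w = d @ [2, n + 2]"
  obtains c where "c \<in> words n" "w = lift c @ [2, n + 2]"
proof -
  obtain c where "c \<in> words n" "d = lift c"
    by (rule words_liftE[of d "[2, n + 2]" "n + 2" n]) (use assms in auto)
  then show ?thesis using that assms by blast
qed

lemma cyc_lift_2_max:
  assumes "c \<in> words n"
  shows "cyc (lift c @ [2, n + 2]) = {(2, n + 2), (n + 2, 1)} \<union> map_prod (spread 1) Suc ` cyc c"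
  using cyc_lift[OF assms, of "[n + 2]"] by auto

lemma av312_lift_2_max: "c \<in> words n \<Longrightarrow> av312 (lift c @ [2, n + 2]) \<longleftrightarrow> av312 c"
  by (rule av312_lift_append) (auto simp: subseq2_Cons simp del: subseq_Cons2_iff)

lemma words_lift_max_2: "c \<in> words n \<Longrightarrow> lift c @ [n + 2, 2] \<in> words (n + 2)"
  by (rule words_lift) (auto dest: words_pos)

lemma words_ends_max_2E:
  assumes "w \<in> words (n + 2)" "1 \<le> n" "w = d @ [n + 2, 2]"
  obtains c where "c \<in> words n" "w = lift c @ [n + 2, 2]"
proof -
  obtain c where "c \<in> words n" "d = lift c"
    by (rule words_liftE[of d "[n + 2, 2]" "n + 2" n]) (use assms in auto)
  then show ?thesis using that assms by blast
qed

lemma av312_lift_max_2: "c \<in> words n \<Longrightarrow> av312 (lift c @ [n + 2, 2]) \<longleftrightarrow> av312 c"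
  by (rule av312_lift_append) (auto simp: subseq2_Cons simp del: subseq_Cons2_iff)

lemma spread_image_bounds:
  assumes "c \<in> words n" "e \<in> map_prod (spread 1) Suc ` cyc c"
  shows "fst e = 1 \<or> 3 \<le> fst e" "fst e \<le> n + 1" "2 \<le> snd e" "snd e \<le> n + 1"
  using assms cyc_word_bounds[OF assms(1)] words_pos[OF assms(1)] by (fastforce simp: spread_def split: if_splits)+

lemma shift_image_bounds:
  assumes "c \<in> words n" "e \<in> map_prod Suc (spread 1) ` cyc c"
  shows "2 \<le> fst e" "fst e \<le> n + 1" "snd e = 1 \<or> 3 \<le> snd e" "snd e \<le> n + 1"
  using assms cyc_word_bounds[OF assms(1)] words_pos[OF assms(1)] by (fastforce simp: spread_def split: if_splits)+

subsection \<open>The patterns 231 and 321\<close>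

text \<open>Only source 1 lies to the left of source 2, so the edge \<open>(2, 1)\<close> cannot
  close a triple. The two conditions say that the pattern has its smallest value neither in the
  middle nor in front, as is the case for 231 and 321.\<close>

lemma avoids_insert_21:
  assumes "\<And>e. e \<in> E \<Longrightarrow> (fst e = 1 \<or> 3 \<le> fst e) \<and> 2 \<le> snd e"
    and R: "\<And>a d. 1 < a \<Longrightarrow> 1 < d \<Longrightarrow> \<not> R a 1 d"
    "\<And>a b. 1 < a \<Longrightarrow> 1 < b \<Longrightarrow> \<not> R 1 a b"
  shows "avoids R (insert (2, 1) E) \<longleftrightarrow> avoids R E"
proof
  assume E: "avoids R E"
  show "avoids R (insert (2, 1) E)"
    unfolding avoids_iff
  proof (intro ballI impI notI)
    fix u v w assume uvw: "u \<in> insert (2, 1) E" "v \<in> insert (2, 1) E" "w \<in> insert (2, 1) E"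
      "fst u < fst v" "fst v < fst w" and r: "R (snd u) (snd v) (snd w)"
    have "w \<noteq> (2, 1)"
    proof
      assume "w = (2, 1)"
      then have "fst u < 1 \<and> u \<in> E" using uvw assms(1)[of v] by auto
      then show False using assms(1)[of u] by auto
    qed
    then have w: "w \<in> E" "1 < snd w" using uvw assms(1)[of w] by auto
    show False
    proof (cases "u = (2, 1)")
      case True
      then show False using r R(2)[of "snd v" "snd w"] w uvw assms(1)[of v] by auto
    next
      case False
      then have u: "u \<in> E" "1 < snd u" using uvw assms(1)[of u] by auto
      show False
      proof (cases "v = (2, 1)")
        case True
        then show False using r R(1) u w by auto
      next
        case False
        then show False using E u w uvw r unfolding avoids_iff by blast
      qed
    qed
  qed
qed (auto intro: avoids_subset)

lemma good_lift_2:
  assumes c: "c \<in> words n"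
    and R: "\<And>a b d. R (Suc a) (Suc b) (Suc d) \<longleftrightarrow> R a b d"
    "\<And>a d. 1 < a \<Longrightarrow> 1 < d \<Longrightarrow> \<not> R a 1 d" "\<And>a b. 1 < a \<Longrightarrow> 1 < b \<Longrightarrow> \<not> R 1 a b"
  shows "lift c @ [2] \<in> good R (Suc n) \<longleftrightarrow> c \<in> good R n"
proof -
  have "avoids R (cyc (lift c @ [2])) \<longleftrightarrow> avoids R (cyc c)"
    unfolding cyc_lift_2[OF c]
    by (subst avoids_insert_21)
      (use spread_image_bounds[OF c] R in \<open>auto simp: avoids_map_prod strict_mono_spread\<close>)
  then show ?thesis using c words_lift_2[OF c] av312_lift_2[OF c] by (simp add: good_def)
qed

lemma card_good_231:
  assumes "1 \<le> n"
  shows "card (good (\<lambda>x y z. z < x \<and> x < y) n) = 1"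
  using assms
proof (induction n rule: nat_induct_at_least)
  case base
  show ?case unfolding good_1 by simp
next
  case (Suc n)
  let ?R = "\<lambda>x y z :: nat. z < x \<and> x < y"
  show ?case
  proof (cases "n = 1")
    case True
    then show ?thesis using good_2[of ?R] by (simp add: numeral_2_eq_2)
  next
    case False
    have "good ?R (Suc n) = (\<lambda>c. lift c @ [2]) ` good ?R n"
    proof (intro equalityI subsetI)
      fix w assume w: "w \<in> good ?R (Suc n)"
      have "last w = 2" by (rule structure_231[OF w]) (use False Suc in linarith)
      then obtain c where "c \<in> words n" "w = lift c @ [2]" using w words_last_2E[of w n] Suc by (auto simp: good_def)
      then show "w \<in> (\<lambda>c. lift c @ [2]) ` good ?R n" using w good_lift_2[of c n ?R] by auto
    next
      fix w assume "w \<in> (\<lambda>c. lift c @ [2]) ` good ?R n"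
      then obtain c where "c \<in> good ?R n" "w = lift c @ [2]" by blast
      then show "w \<in> good ?R (Suc n)" using good_lift_2[of c n ?R] by (auto simp: good_def)
    qed
    moreover have "inj_on (\<lambda>c. lift c @ [2]) (good ?R n)"
      using inj_on_lift[of n] by (auto simp: inj_on_def good_def)
    ultimately show ?thesis using Suc by (simp add: card_image)
  qed
qed

text \<open>The edge \<open>(1, 2)\<close> has the smallest source and can only open a triple. Since
  1 is the only target below 2, this is harmless for patterns whose first value exceeds both
  others.\<close>

lemma good_glue_1:
  assumes c: "c \<in> words n"
    and R: "\<And>a b d. R (spread 1 a) (spread 1 b) (spread 1 d) \<longleftrightarrow> R a b d"
    "\<And>b d. b = 1 \<or> 3 \<le> b \<Longrightarrow> d = 1 \<or> 3 \<le> d \<Longrightarrow> \<not> R 2 b d"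
  shows "glue [Suc 0] c \<in> good R (Suc n) \<longleftrightarrow> c \<in> good R n"
proof -
  let ?E = "map_prod Suc (spread 1) ` cyc c"
  have "avoids R (insert (1, 2) ?E) \<longleftrightarrow> avoids R ?E"
  proof
    assume E: "avoids R ?E"
    show "avoids R (insert (1, 2) ?E)"
      unfolding avoids_iff
    proof (intro ballI impI notI)
      fix u v w assume uvw: "u \<in> insert (1, 2) ?E" "v \<in> insert (1, 2) ?E" "w \<in> insert (1, 2) ?E"
        "fst u < fst v" "fst v < fst w" and r: "R (snd u) (snd v) (snd w)"
      have "1 \<le> fst u" using uvw(1) shift_image_bounds[OF c, of u] by auto
      then have vw: "v \<in> ?E" "w \<in> ?E" using uvw by auto
      show False
      proof (cases "u = (1, 2)")
        case True
        then show False using r R(2) shift_image_bounds(3)[OF c] vw by auto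
      next
        case False
        then show False using E vw uvw r unfolding avoids_iff by blast
      qed
    qed
  qed (auto intro: avoids_subset)
  also have "avoids R ?E \<longleftrightarrow> avoids R (cyc c)"
    by (rule avoids_map_prod) (use R in \<open>auto simp: strict_mono_def\<close>)
  finally show ?thesis using c words_glue_1[OF c] av312_glue_1[OF c] by (simp add: good_def cyc_glue_1)
qed

lemma card_good_321:
  assumes "2 \<le> n"
  shows "card (good (\<lambda>x y z. z < y \<and> y < x) n) = 2 ^ (n - 2)"
  using assms
proof (induction n rule: nat_induct_at_least)
  case base
  show ?case by (simp add: good_2)
next
  case (Suc n)
  let ?R = "\<lambda>x y z :: nat. z < y \<and> y < x"
  let ?A = "(\<lambda>c. lift c @ [2]) ` good ?R n" and ?B = "glue [Suc 0] ` good ?R n"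
  have words: "c \<in> good ?R n \<Longrightarrow> c \<in> words n" for c by (simp add: good_def)
  have lift: "lift c @ [2] \<in> good ?R (Suc n) \<longleftrightarrow> c \<in> good ?R n" if "c \<in> words n" for c
    using that by (rule good_lift_2) auto
  have glue: "glue [Suc 0] c \<in> good ?R (Suc n) \<longleftrightarrow> c \<in> good ?R n" if "c \<in> words n" for c
    using that by (rule good_glue_1) auto
  have "good ?R (Suc n) = ?A \<union> ?B"
  proof (intro equalityI subsetI)
    fix w assume w: "w \<in> good ?R (Suc n)"
    then have ww: "w \<in> words (Suc n)" by (simp add: good_def)
    have n: "1 \<le> n" "3 \<le> Suc n" using Suc by auto
    show "w \<in> ?A \<union> ?B"
      using structure_321[OF w n(2)]
    proof
      assume "w ! 1 = 2"
      then obtain c where "c \<in> words n" "w = glue [Suc 0] c" using words_nth_1_eq_2E[OF ww n(1)] by blast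
      then show ?thesis using w glue by blast
    next
      assume "last w = 2"
      then obtain c where "c \<in> words n" "w = lift c @ [2]" using words_last_2E[OF ww n(1)] by blast
      then show ?thesis using w lift by blast
    qed
  next
    fix w assume "w \<in> ?A \<union> ?B"
    then show "w \<in> good ?R (Suc n)" using lift glue words by blast
  qed
  \<comment> \<open>The second entry tells the two copies apart: it is 2 after gluing and at least 3
    after lifting.\<close>
  moreover have "?A \<inter> ?B = {}"
  proof -
    have "lift c @ [2] \<noteq> glue [Suc 0] d" if "c \<in> words n" "d \<in> words n" for c d
      using lift_nth_1[OF that(1) Suc(1), of "[2]"] glue_1_nth_1[OF that(2)] by auto
    then show ?thesis using words by blast
  qed
  moreover have "card ?A = card (good ?R n)"
    by (rule card_image) (use inj_on_lift[of n] in \<open>auto simp: inj_on_def good_def\<close>)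
  moreover have "card ?B = card (good ?R n)"
    by (rule card_image) (metis inj_glue inj_on_subset subset_UNIV)
  moreover have "card (?A \<union> ?B) = card ?A + card ?B"
    by (rule card_Un_disjoint) (use calculation finite_good in auto)
  moreover have "(2::nat) ^ (Suc n - 2) = 2 ^ (n - 2) + 2 ^ (n - 2)"
    using Suc(1) by (metis Suc_diff_le mult_2 power_Suc)
  ultimately show ?case using Suc(2) by metis
qed

subsection \<open>The patterns 132 and 213\<close>

lemma words_dec: "1 \<le> n \<Longrightarrow> dec n \<in> words n"
  unfolding dec_def by (rule wordsI) (auto simp del: upt_Suc)

lemma av312_dec: "av312 (dec n)"
proof -
  have "z < y" if "subseq [y, z] (rev [2..<Suc n])" for y z
    using that by (auto simp: subseq2_nth rev_nth simp del: upt_Suc)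
  then show ?thesis unfolding av312_def dec_def subseq3_Cons
    by (meson order.asym subseq_Cons')
qed

lemma last_dec: "2 \<le> n \<Longrightarrow> last (dec n) = 2"
  unfolding dec_def by (subst upt_conv_Cons) (simp_all del: upt_Suc)

lemma rev_upt_Suc: "2 \<le> n \<Longrightarrow> rev [2..<Suc n] = n # rev [2..<n]"
  by simp

lemma steps_rev_upt: "2 \<le> n \<Longrightarrow> steps (rev [2..<Suc n]) = {(x, x - 1) | x. 3 \<le> x \<and> x \<le> n}"
proof (induction n rule: nat_induct_at_least)
  case base
  have "rev [2..<Suc 2] = [2]" by simp
  then show ?case by simp
next
  case (Suc n)
  have r: "rev [2..<Suc n] = n # rev [2..<n]" using Suc(1) by (rule rev_upt_Suc)
  have "rev [2..<Suc (Suc n)] = Suc n # rev [2..<Suc n]" using Suc(1) by (intro rev_upt_Suc) simp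
  then have "steps (rev [2..<Suc (Suc n)]) = insert (Suc n, n) (steps (rev [2..<Suc n]))"
    using r by simp
  also have "\<dots> = {(x, x - 1) | x. 3 \<le> x \<and> x \<le> Suc n}"
    unfolding Suc(2) using Suc(1) by (auto simp: le_Suc_eq)
  finally show ?case .
qed

lemma steps_dec:
  assumes "2 \<le> n"
  shows "steps (dec n) = insert (1, n) {(x, x - 1) | x. 3 \<le> x \<and> x \<le> n}"
proof -
  have "steps (dec n) = insert (1, n) (steps (rev [2..<Suc n]))"
    unfolding dec_def rev_upt_Suc[OF assms] by simp
  then show ?thesis unfolding steps_rev_upt[OF assms] .
qed

lemma cyc_dec: "2 \<le> n \<Longrightarrow> cyc (dec n) = {(1, n), (2, 1)} \<union> {(x, x - 1) | x. 3 \<le> x \<and> x \<le> n}"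
  using last_dec[of n] steps_dec[of n] cyc_word[OF words_dec[of n]] by auto

lemma dec_good:
  assumes "2 \<le> n"
  shows "dec n \<in> good (\<lambda>x y z. x < z \<and> z < y) n" "dec n \<in> good (\<lambda>x y z. y < x \<and> x < z) n"
proof -
  have "avoids (\<lambda>x y z. x < z \<and> z < y) (cyc (dec n))" "avoids (\<lambda>x y z. y < x \<and> x < z) (cyc (dec n))"
    unfolding avoids_iff cyc_dec[OF assms] using assms by auto
  then show "dec n \<in> good (\<lambda>x y z. x < z \<and> z < y) n" "dec n \<in> good (\<lambda>x y z. y < x \<and> x < z) n"
    using assms words_dec[of n] av312_dec[of n] by (simp_all add: good_def)
qed

lemma words_snoc: "c \<in> words n \<Longrightarrow> c @ [Suc n] \<in> words (Suc n)"
  by (auto simp: words_def)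

lemma words_snocD: "d @ [Suc n] \<in> words (Suc n) \<Longrightarrow> 1 \<le> n \<Longrightarrow> d \<in> words n"
proof -
  assume w: "d @ [Suc n] \<in> words (Suc n)" and n: "1 \<le> n"
  then have d: "distinct d" "Suc n \<notin> set d" "insert (Suc n) (set d) = {1..Suc n}" "hd (d @ [Suc n]) = 1"
    by (simp_all add: words_def)
  have "set d = {1..Suc n} - {Suc n}" using d(2,3) by blast
  also have "\<dots> = {1..n}" by auto
  finally have s: "set d = {1..n}" .
  then have "d \<noteq> []" using n by auto
  then show ?thesis using d(1,4) s by (simp add: words_def)
qed

lemma av312_snoc: "c \<in> words n \<Longrightarrow> av312 (c @ [Suc n]) \<longleftrightarrow> av312 c"
  unfolding av312_append by (auto dest!: subseq2_set simp: words_def simp del: subseq_Cons2_iff)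

lemma cyc_snoc: "c \<in> words n \<Longrightarrow> cyc (c @ [Suc n]) = steps c \<union> {(last c, Suc n), (Suc n, 1)}"
  by (auto simp: cyc_def steps_append words_def)

lemma words_steps_bounds: "c \<in> words n \<Longrightarrow> e \<in> steps c \<Longrightarrow> 1 \<le> fst e \<and> fst e \<le> n \<and> 2 \<le> snd e \<and> snd e \<le> n"
  using steps_subset[of c] words_tl(3)[of c n] by (auto simp: words_def)

text \<open>Appending \<open>n + 1\<close> replaces the edge \<open>(n, 1)\<close> by
  \<open>(n, n + 1)\<close> and \<open>(n + 1, 1)\<close>. None of these can close a 132, as their
  values are smallest or largest, and none has a source small enough to come earlier in one. So both
  sides reduce to the path edges of \<open>c\<close>.\<close>

lemma snoc_good_132:
  assumes c: "c \<in> words n" and last: "last c = n"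
  shows "c @ [Suc n] \<in> good (\<lambda>x y z. x < z \<and> z < y) (Suc n) \<longleftrightarrow> c \<in> good (\<lambda>x y z. x < z \<and> z < y) n"
proof -
  let ?R = "\<lambda>x y z :: nat. x < z \<and> z < y"
  have b: "\<And>e. e \<in> steps c \<Longrightarrow> 1 \<le> fst e \<and> fst e \<le> n \<and> 2 \<le> snd e \<and> snd e \<le> n"
    using words_steps_bounds[OF c] .
  have "avoids ?R (cyc c) \<longleftrightarrow> avoids ?R (steps c)"
  proof
    assume s: "avoids ?R (steps c)"
    show "avoids ?R (cyc c)"
      unfolding avoids_iff cyc_word[OF c] last
    proof (intro ballI impI notI)
      fix u v w assume uvw: "u \<in> insert (n, 1) (steps c)" "v \<in> insert (n, 1) (steps c)"
        "w \<in> insert (n, 1) (steps c)" "fst u < fst v" "fst v < fst w" "snd u < snd w \<and> snd w < snd v"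
      then have "w \<in> steps c" using b[of u] by auto
      moreover from this have "u \<in> steps c" "v \<in> steps c" using uvw b[of w] by auto
      ultimately show False using s uvw unfolding avoids_iff by blast
    qed
  qed (auto intro: avoids_subset simp: cyc_word[OF c])
  moreover have "avoids ?R (cyc (c @ [Suc n])) \<longleftrightarrow> avoids ?R (steps c)"
  proof
    assume s: "avoids ?R (steps c)"
    show "avoids ?R (cyc (c @ [Suc n]))"
      unfolding avoids_iff cyc_snoc[OF c] last
    proof (intro ballI impI notI)
      let ?E = "steps c \<union> {(n, Suc n), (Suc n, 1)}"
      fix u v w assume uvw: "u \<in> ?E" "v \<in> ?E" "w \<in> ?E" "fst u < fst v" "fst v < fst w"
        "snd u < snd w \<and> snd w < snd v"
      then have "w \<noteq> (Suc n, 1)" using b[of u] by auto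
      moreover have "w \<noteq> (n, Suc n)" using uvw b[of v] by auto
      ultimately have "w \<in> steps c" using uvw by auto
      moreover from this have "u \<in> steps c" "v \<in> steps c" using uvw b[of w] by auto
      ultimately show False using s uvw unfolding avoids_iff by blast
    qed
  qed (auto intro: avoids_subset simp: cyc_snoc[OF c])
  ultimately show ?thesis using c words_snoc[OF c] av312_snoc[OF c] by (simp add: good_def)
qed

text \<open>For \<open>n \<ge> 3\<close> the word \<open>dec n\<close> does not end with its maximum
  and needs a separate check. The result has the one-line notation
  \<open>n, n + 1, 2, 3, ..., n - 1, 1\<close>.\<close>

lemma snoc_dec_good_132:
  assumes n: "2 \<le> n"
  shows "dec n @ [Suc n] \<in> good (\<lambda>x y z. x < z \<and> z < y) (Suc n)"
proof -
  have d: "dec n \<in> words n" using n by (simp add: words_dec)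
  have "avoids (\<lambda>x y z. x < z \<and> z < y) (cyc (dec n @ [Suc n]))"
    unfolding avoids_iff cyc_snoc[OF d] steps_dec[OF n] last_dec[OF n] using n by auto
  then show ?thesis
    using words_snoc[OF d] av312_snoc[OF d] av312_dec[of n] by (simp add: good_def)
qed

lemma good_132_last:
  assumes c: "c \<in> good (\<lambda>x y z. x < z \<and> z < y) n" and n: "2 \<le> n"
  shows "c = dec n \<or> last c = n"
proof (cases "n = 2")
  case True
  then show ?thesis using c by (auto simp: good_2)
next
  case False
  then show ?thesis using structure_132[OF c] n by auto
qed

lemma card_good_132:
  assumes "2 \<le> n"
  shows "card (good (\<lambda>x y z. x < z \<and> z < y) n) = n - 1"
  using assms
proof (induction n rule: nat_induct_at_least)
  case base
  show ?case by (simp add: good_2)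
next
  case (Suc n)
  let ?R = "\<lambda>x y z :: nat. x < z \<and> z < y"
  let ?A = "(\<lambda>c. c @ [Suc n]) ` good ?R n"
  have "good ?R (Suc n) = insert (dec (Suc n)) ?A"
  proof (intro equalityI subsetI)
    fix w assume w: "w \<in> good ?R (Suc n)"
    then have ww: "w \<in> words (Suc n)" "av312 w" by (auto simp: good_def)
    have n3: "3 \<le> Suc n" using Suc by simp
    from structure_132[OF w n3]
    consider "w = dec (Suc n)" | d where "w = d @ [n, Suc n]" | "w ! 1 = n" "last w = Suc n" by auto
    then show "w \<in> insert (dec (Suc n)) ?A"
    proof cases
      case 1
      then show ?thesis by simp
    next
      case 2
      then have eq: "w = (d @ [n]) @ [Suc n]" by simp
      then have "d @ [n] \<in> words n" using words_snocD ww Suc by (metis One_nat_def Suc_leD numeral_2_eq_2)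
      then have "d @ [n] \<in> good ?R n" using snoc_good_132[of "d @ [n]" n] w eq by simp
      then show ?thesis using eq by blast
    next
      \<comment> \<open>Without its last entry the word has its maximum \<open>n\<close> right after
        1, which makes it \<open>dec n\<close>.\<close>
      case 3
      have eq: "w = butlast w @ [Suc n]" using 3(2) ww(1) words_tl(1) by (metis append_butlast_last_id list.distinct(1))
      then have b: "butlast w \<in> words n" using words_snocD ww Suc by (metis One_nat_def Suc_leD numeral_2_eq_2)
      then have "av312 (butlast w)" using av312_snoc eq ww by metis
      moreover have "butlast w ! 1 = n"
        using 3 Suc words_length[OF b] by (simp add: nth_butlast)
      ultimately have "butlast w = dec n" using dec_unique[OF b] Suc by simp
      then have "butlast w \<in> good ?R n" using dec_good Suc by simp
      then show ?thesis using eq by blast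
    qed
  next
    fix w assume "w \<in> insert (dec (Suc n)) ?A"
    then consider "w = dec (Suc n)" | c where "w = c @ [Suc n]" "c \<in> good ?R n" by blast
    then show "w \<in> good ?R (Suc n)"
    proof cases
      case 1
      then show ?thesis using dec_good[of "Suc n"] Suc by simp
    next
      case 2
      then have "c \<in> words n" by (simp add: good_def)
      then show ?thesis using good_132_last[OF 2(2) Suc(1)] 2 snoc_dec_good_132[OF Suc(1)] snoc_good_132 by blast
    qed
  qed
  moreover have "dec (Suc n) \<notin> ?A"
  proof
    assume "dec (Suc n) \<in> ?A"
    then have "last (dec (Suc n)) = Suc n" by auto
    then show False using last_dec[of "Suc n"] Suc by simp
  qed
  moreover have "card ?A = card (good ?R n)" by (rule card_image) (auto simp: inj_on_def)
  moreover have "finite ?A" using finite_good by blast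
  ultimately show ?case using Suc by simp
qed

text \<open>The edge \<open>(n + 2, 1)\<close> has the largest source and could only close a triple;
  \<open>(2, n + 2)\<close> has the largest value and only source 1 before it, so it could only be
  first or middle. The conditions on \<open>R\<close> exclude these roles; they hold for patterns
  that end with their largest value, here 123 and 213.\<close>

lemma good_lift_2_max:
  assumes c: "c \<in> words n"
    and R: "\<And>a b d. R (Suc a) (Suc b) (Suc d) \<longleftrightarrow> R a b d"
    "\<And>a b. 1 \<le> a \<Longrightarrow> 1 \<le> b \<Longrightarrow> \<not> R a b 1"
    "\<And>a b d. b < a \<Longrightarrow> d < a \<Longrightarrow> \<not> R a b d" "\<And>a b d. a < b \<Longrightarrow> d < b \<Longrightarrow> \<not> R a b d"
  shows "lift c @ [2, n + 2] \<in> good R (n + 2) \<longleftrightarrow> c \<in> good R n"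
proof -
  let ?E = "map_prod (spread 1) Suc ` cyc c"
  note b = spread_image_bounds[OF c]
  have "avoids R ({(2, n + 2), (n + 2, 1)} \<union> ?E) \<longleftrightarrow> avoids R ?E"
  proof
    assume E: "avoids R ?E"
    show "avoids R ({(2, n + 2), (n + 2, 1)} \<union> ?E)"
      unfolding avoids_iff
    proof (intro ballI impI notI)
      let ?F = "{(2, n + 2), (n + 2, 1)} \<union> ?E"
      fix u v w assume uvw: "u \<in> ?F" "v \<in> ?F" "w \<in> ?F" "fst u < fst v" "fst v < fst w"
        and r: "R (snd u) (snd v) (snd w)"
      have pos: "1 \<le> fst e \<and> 1 \<le> snd e \<and> fst e \<le> n + 2 \<and> snd e \<le> n + 2" if "e \<in> ?F" for e
      proof (cases "e \<in> ?E")
        case True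
        show ?thesis using b[OF True] by linarith
      next
        case False
        then show ?thesis using that by auto
      qed
      have "w \<noteq> (n + 2, 1)" using r R(2) pos[OF uvw(1)] pos[OF uvw(2)] by auto
      moreover have "w \<noteq> (2, n + 2)" using uvw(4,5) pos[OF uvw(1)] by auto
      ultimately have w: "w \<in> ?E" "fst w < n + 2" "snd w < n + 2" using uvw b(2,4)[of w] by auto
      have "v \<noteq> (n + 2, 1)" using w(2) uvw(5) by auto
      moreover have "v \<noteq> (2, n + 2)"
      proof
        assume v: "v = (2, n + 2)"
        then have "u \<in> ?E" using uvw pos[OF uvw(1)] w by auto
        then show False using r R(4) w v b(4)[of u] by auto
      qed
      ultimately have v: "v \<in> ?E" using uvw by auto
      have "u \<noteq> (n + 2, 1)" using uvw(4) pos[OF uvw(2)] by auto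
      moreover have "u \<noteq> (2, n + 2)" using r R(3) w b(4)[OF v] by auto
      ultimately have "u \<in> ?E" using uvw by auto
      then show False using E v w(1) uvw(4,5) r unfolding avoids_iff by blast
    qed
  qed (auto intro: avoids_subset)
  also have "avoids R ?E \<longleftrightarrow> avoids R (cyc c)"
    by (rule avoids_map_prod) (rule strict_mono_spread, rule R(1))
  finally have "avoids R (cyc (lift c @ [2, n + 2])) \<longleftrightarrow> avoids R (cyc c)" unfolding cyc_lift_2_max[OF c] .
  then show ?thesis using c words_lift_2_max[OF c] av312_lift_2_max[OF c] by (simp add: good_def)
qed

text \<open>For 213 the new edge \<open>(1, 2)\<close> could open the pattern
  \<open>2, 1, d\<close>. The assumption \<open>last c = n\<close> prevents this by putting the
  value 1 at the very end of the one-line word.\<close>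

lemma good_glue_1_213:
  assumes c: "c \<in> words n" and last: "last c = n"
  shows "glue [Suc 0] c \<in> good (\<lambda>x y z. y < x \<and> x < z) (Suc n) \<longleftrightarrow> c \<in> good (\<lambda>x y z. y < x \<and> x < z) n"
proof -
  let ?R = "\<lambda>x y z :: nat. y < x \<and> x < z"
  let ?E = "map_prod Suc (spread 1) ` cyc c"
  note b = shift_image_bounds[OF c]
  have one: "fst e = Suc n" if "e \<in> ?E" "snd e = 1" for e
  proof -
    from \<open>e \<in> ?E\<close> obtain f where f: "e = map_prod Suc (spread 1) f" "f \<in> cyc c" by (rule imageE)
    then have "spread 1 (snd f) = 1" using \<open>snd e = 1\<close> by simp
    then have "snd f \<le> 1" by (auto simp: spread_def split: if_splits)
    then have "f \<notin> steps c" using words_steps_bounds[OF c, of f] by auto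
    then show ?thesis using f last by (auto simp: cyc_word[OF c])
  qed
  have "avoids ?R (insert (1, 2) ?E) \<longleftrightarrow> avoids ?R ?E"
  proof
    assume E: "avoids ?R ?E"
    show "avoids ?R (insert (1, 2) ?E)"
      unfolding avoids_iff
    proof (intro ballI impI notI)
      fix u v w assume uvw: "u \<in> insert (1, 2) ?E" "v \<in> insert (1, 2) ?E" "w \<in> insert (1, 2) ?E"
        "fst u < fst v" "fst v < fst w" and r: "snd v < snd u \<and> snd u < snd w"
      have "1 \<le> fst u" using uvw(1) b[of u] by auto
      then have vw: "v \<in> ?E" "w \<in> ?E" using uvw by auto
      show False
      proof (cases "u = (1, 2)")
        case True
        then have "snd v = 1" using r b(3)[OF vw(1)] by auto
        then show False using one[OF vw(1)] b(2)[OF vw(2)] uvw by auto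
      next
        case False
        then show False using E vw uvw r unfolding avoids_iff by blast
      qed
    qed
  qed (auto intro: avoids_subset)
  also have "avoids ?R ?E \<longleftrightarrow> avoids ?R (cyc c)"
    by (rule avoids_map_prod) (auto simp: strict_mono_def)
  finally show ?thesis using c words_glue_1[OF c] av312_glue_1[OF c] by (simp add: good_def cyc_glue_1)
qed

lemma card_good_213_3: "card (good (\<lambda>x y z. y < x \<and> x < z) 3) = 2"
proof -
  have "good (\<lambda>x y z. y < x \<and> x < z) 3 = {[1, 2, 3], [1, 3, 2]}"
    unfolding good_def words_3
    by (auto simp: avoids_iff cyc_def av312_def subseq3_Cons subseq2_Cons simp del: subseq_Cons2_iff)
  then show ?thesis by simp
qed

lemma last_glue_1: "c \<in> words n \<Longrightarrow> last (glue [Suc 0] c) = Suc (last c)"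
  by (auto simp: glue_def words_def last_map)

text \<open>A leading \<open>1, 2\<close> may be added only to words that end with their maximum, so
  the recursion runs over the set \<open>B k\<close> of these. From length 3 on it misses just
  \<open>dec k\<close>; adding this one word on both sides turns the recursion for \<open>B\<close>
  into the Fibonacci recursion.\<close>

lemma card_good_213_rec:
  assumes n: "4 \<le> n"
  shows "card (good (\<lambda>x y z. y < x \<and> x < z) n) =
    card (good (\<lambda>x y z. y < x \<and> x < z) (n - 1)) + card (good (\<lambda>x y z. y < x \<and> x < z) (n - 2))"
proof -
  let ?R = "\<lambda>x y z :: nat. y < x \<and> x < z"
  define B where "B k = {c \<in> good ?R k. last c = k}" for k
  have fin: "finite (B k)" for k using finite_good by (simp add: B_def)
  have B: "good ?R k = insert (dec k) (B k)" "dec k \<notin> B k" if k: "3 \<le> k" for k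
  proof -
    have "c = dec k \<or> last c = k" if "c \<in> good ?R k" for c
      using structure_213[OF that k] by auto
    then show "good ?R k = insert (dec k) (B k)"
      using dec_good(2)[of k] k by (auto simp: B_def)
    show "dec k \<notin> B k" using last_dec[of k] k by (auto simp: B_def)
  qed
  have card_B: "card (good ?R k) = Suc (card (B k))" if "3 \<le> k" for k
    using B[OF that] fin by simp
  define k where "k = n - 2"
  have k: "n = k + 2" "2 \<le> k" using n unfolding k_def by linarith+
  let ?L = "(\<lambda>c. lift c @ [2, k + 2]) ` good ?R k" and ?G = "glue [Suc 0] ` B (k + 1)"
  have words: "c \<in> good ?R m \<Longrightarrow> c \<in> words m" "c \<in> B m \<Longrightarrow> c \<in> words m" for c m by (auto simp: good_def B_def)
  have lift: "lift c @ [2, k + 2] \<in> good ?R (k + 2) \<longleftrightarrow> c \<in> good ?R k" if "c \<in> words k" for c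
    using that by (rule good_lift_2_max) auto
  have "B (k + 2) = ?L \<union> ?G"
  proof (intro equalityI subsetI)
    fix w assume "w \<in> B (k + 2)"
    then have w: "w \<in> good ?R (k + 2)" "last w = k + 2" "w \<in> words (k + 2)" by (auto simp: B_def good_def)
    have "w \<noteq> dec (k + 2)" using w last_dec[of "k + 2"] k by auto
    then consider "w ! 1 = 2" | d where "w = d @ [2, k + 2]" using structure_213[OF w(1)] k by auto
    then show "w \<in> ?L \<union> ?G"
    proof cases
      case 1
      then obtain c where c: "c \<in> words (k + 1)" "w = glue [Suc 0] c" using words_nth_1_eq_2E[of w "k + 1"] w by auto
      then have "last c = k + 1" using w last_glue_1 by auto
      then have "c \<in> B (k + 1)" using good_glue_1_213[of c "k + 1"] c w by (simp add: B_def)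
      then show ?thesis using c by blast
    next
      case 2
      then obtain c where c: "c \<in> words k" "w = lift c @ [2, k + 2]" using words_ends_2_maxE[of w k d] w k by auto
      then show ?thesis using lift w by blast
    qed
  next
    fix w assume "w \<in> ?L \<union> ?G"
    then consider c where "c \<in> good ?R k" "w = lift c @ [2, k + 2]" | c where "c \<in> B (k + 1)" "w = glue [Suc 0] c" by blast
    then show "w \<in> B (k + 2)"
    proof cases
      case 1
      then show ?thesis using lift words by (auto simp: B_def)
    next
      case 2
      then show ?thesis using good_glue_1_213[of c "k + 1"] words last_glue_1[of c "k + 1"] by (auto simp: B_def)
    qed
  qed
  moreover have "?L \<inter> ?G = {}"
  proof -
    have "lift c @ [2, k + 2] \<noteq> glue [Suc 0] d" if "c \<in> words k" "d \<in> words (k + 1)" for c d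
      using lift_nth_1[OF that(1) k(2), of "[2, k + 2]"] glue_1_nth_1[OF that(2)] by auto
    then show ?thesis using words by blast
  qed
  moreover have "card ?L = card (good ?R k)"
    by (rule card_image) (use inj_on_lift[of k] in \<open>auto simp: inj_on_def good_def\<close>)
  moreover have "card ?G = card (B (k + 1))"
    by (rule card_image) (metis inj_glue inj_on_subset subset_UNIV)
  moreover have "card (?L \<union> ?G) = card ?L + card ?G"
    by (rule card_Un_disjoint) (use calculation finite_good fin in auto)
  ultimately have "card (B (k + 2)) = card (good ?R k) + card (B (k + 1))" by simp
  then show ?thesis using card_B[of "k + 2"] card_B[of "k + 1"] k by simp
qed

lemma card_good_213:
  "2 \<le> n \<Longrightarrow> card (good (\<lambda>x y z. y < x \<and> x < z) n) = fib n"
proof (induction n rule: less_induct)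
  case (less n)
  consider "n = 2" | "n = 3" | "4 \<le> n" using less.prems by linarith
  then show ?case
  proof cases
    case 1
    have "fib 2 = 1" by (simp add: numeral_2_eq_2)
    then show ?thesis unfolding 1 good_2 by simp
  next
    case 2
    have "fib 3 = 2" by (simp add: numeral_3_eq_3)
    then show ?thesis unfolding 2 card_good_213_3 by simp
  next
    case 3
    define k where "k = n - 2"
    have k: "n = Suc (Suc k)" "2 \<le> k" "n - 1 = Suc k" using 3 unfolding k_def by linarith+
    have "card (good (\<lambda>x y z. y < x \<and> x < z) n) = fib (Suc k) + fib k"
      unfolding card_good_213_rec[OF 3] k(3) k_def[symmetric]
      using less.IH[of "Suc k"] less.IH[of k] k by simp
    then show ?thesis unfolding k(1) by simp
  qed
qed

text \<open>
  There is exactly one such word of each length \<open>r \<ge> 2\<close>, for instance 1 5 4 6 3 7 2.  It is the only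
  admissible word of length \<open>r\<close> for 123 that ends with 2 and, if \<open>r \<ge> 3\<close>, the only first block of
  length \<open>r\<close> of an admissible word for 312.
\<close>

definition desc_words :: "nat \<Rightarrow> nat list set" where
  "desc_words r = {u \<in> words r. descending u \<and> last u = 2}"

lemma desc_words_2: "desc_words 2 = {[1, 2]}"
  unfolding desc_words_def words_2 by (auto simp: descending_def)

lemma desc_words_3: "desc_words 3 = {[1, 3, 2]}"
  unfolding desc_words_def words_3 by (auto simp: descending_def)

lemma steps_not_last: "distinct c \<Longrightarrow> (last c, a) \<notin> steps c"
proof (induction c rule: steps.induct)
  case (1 x y zs)
  then show ?case by auto
qed auto

lemma steps_lift_max_2:
  assumes "c \<in> words n" "last c = 2"
  shows "steps (lift c @ [n + 2, 2]) = {(3, n + 2), (n + 2, 2)} \<union> map_prod (spread 1) Suc ` steps c"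
proof -
  have "lift c \<noteq> []" by (simp add: lift_def)
  moreover have "last (lift c) = 3" using last_lift[OF assms(1)] assms(2) by (simp add: spread_def)
  ultimately show ?thesis by (auto simp: steps_append steps_lift[OF assms(1)])
qed

text \<open>Targets decrease along the sources from 3 on. The least target 2 therefore comes from
  the largest source \<open>r\<close>, and the largest target \<open>r\<close> from source 3. Source
  1 is out of the question, as \<open>r \<ge> 4\<close> leaves other entries between 1 and the
  end.\<close>

lemma desc_words_ends:
  assumes u: "u \<in> desc_words r" and r: "4 \<le> r"
  shows "\<exists>d. u = (d @ [3]) @ [r, 2]"
proof -
  interpret word r u using u by unfold_locales (simp add: desc_words_def)
  have desc: "b < a" if "(i, a) \<in> steps u" "(j, b) \<in> steps u" "3 \<le> i" "i < j" for i a j b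
    using u that unfolding desc_words_def descending_def by blast
  have mem: "2 \<in> {1..r}" "r \<in> {1..r}" "3 \<in> {1..r}" using r by auto
  have last: "p 2 + 1 = r" using p_last[OF mem(1)] u by (simp add: desc_words_def)
  have before: "p x + 1 < r" if "x \<in> {1..r}" "x \<noteq> 2" for x
    using p_less[OF that(1)] p_eq[OF that(1) mem(1)] that(2) last by auto
  have step: "(x, nx x) \<in> steps u" if "x \<in> {1..r}" "x \<noteq> 2" for x
    unfolding steps_c using that before by blast
  have pn: "nx x \<noteq> 1 \<and> p (nx x) = p x + 1" if "x \<in> {1..r}" "x \<noteq> 2" for x
    using that before[OF that] nx_1_iff[OF that(1)] p_nx[OF that(1)] by auto
  obtain t where t: "t \<in> {1..r}" "nx t = 2" using pred[OF mem(1)] by blast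
  have t2: "t \<noteq> 2" using nx_neq[OF t(1)] t(2) r by auto
  have t1: "t \<noteq> 1" using pn[OF t(1) t2] t(2) p_1 last r by auto
  then have t3: "3 \<le> t" using t(1) t2 by auto
  have "t = r"
  proof (rule ccontr)
    assume "t \<noteq> r"
    then have "t < r" using t(1) by auto
    then have "nx r < 2" using desc[OF step[OF t(1) t2] step[OF mem(2)] t3] t(2) r by auto
    moreover have "nx r \<noteq> 1" using pn[OF mem(2)] r by auto
    ultimately show False using nx_mem[OF mem(2)] by auto
  qed
  then have pr: "p r + 1 = p 2" using pn[OF t(1) t2] t(2) by simp
  obtain s where s: "s \<in> {1..r}" "nx s = r" using pred[OF mem(2)] by blast
  have s2: "s \<noteq> 2"
  proof
    assume "s = 2"
    then show False using s nx_1_iff[OF mem(1)] last r by auto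
  qed
  have ps: "p s + 1 = p r" using pn[OF s(1) s2] s(2) by simp
  have s1: "s \<noteq> 1" using ps pr last p_1 r by auto
  have "s = 3"
  proof (rule ccontr)
    assume "s \<noteq> 3"
    then have "3 < s" using s(1) s1 s2 by auto
    then have "r < nx 3" using desc[OF step[OF mem(3)] step[OF s(1) s2]] s(2) by auto
    then show False using nx_mem[OF mem(3)] by auto
  qed
  have "drop (p s) u = u ! p s # drop (Suc (p s)) u" "drop (p r) u = u ! p r # drop (Suc (p r)) u"
    "drop (p 2) u = u ! p 2 # drop (Suc (p 2)) u"
    using p_less[OF s(1)] p_less[OF mem(2)] p_less[OF mem(1)] len by (metis Cons_nth_drop_Suc)+
  moreover have "drop (Suc (p 2)) u = []" using last len by simp
  moreover have "Suc (p s) = p r" "Suc (p r) = p 2" using ps pr by auto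
  ultimately have "drop (p s) u = [s, r, 2]" using nth_p[OF s(1)] nth_p[OF mem(2)] nth_p[OF mem(1)] by simp
  then have "u = (take (p s) u @ [3]) @ [r, 2]" using \<open>s = 3\<close> by (metis append.assoc append_Cons append_Nil append_take_drop_id)
  then show ?thesis by blast
qed

text \<open>A final 2 in \<open>c\<close> is lifted to 3, so the new edges are
  \<open>(3, n + 2)\<close> and \<open>(n + 2, 2)\<close>. They extend the decreasing sequence of
  targets at both ends: largest target at the smallest source, smallest target at the largest
  one.\<close>

lemma desc_words_lift_max_2:
  assumes c: "c \<in> words n" and n: "2 \<le> n"
  shows "lift c @ [n + 2, 2] \<in> desc_words (n + 2) \<and> last (lift c) = 3 \<longleftrightarrow> c \<in> desc_words n"
proof -
  have last: "last (lift c) = 3 \<longleftrightarrow> last c = 2"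
    using last_lift[OF c] words_last[OF c] by (auto simp: spread_def)
  have "descending (lift c @ [n + 2, 2]) \<longleftrightarrow> descending c" if l: "last c = 2"
  proof
    assume d: "descending (lift c @ [n + 2, 2])"
    show "descending c"
      unfolding descending_def
    proof (intro allI impI)
      fix i a j b assume h: "(i, a) \<in> steps c \<and> (j, b) \<in> steps c \<and> 3 \<le> i \<and> i < j"
      then have "map_prod (spread 1) Suc (i, a) \<in> steps (lift c @ [n + 2, 2])"
        "map_prod (spread 1) Suc (j, b) \<in> steps (lift c @ [n + 2, 2])"
        unfolding steps_lift_max_2[OF c l] by blast+
      then have "(Suc i, Suc a) \<in> steps (lift c @ [n + 2, 2])" "(Suc j, Suc b) \<in> steps (lift c @ [n + 2, 2])"
        using h by (auto simp: spread_def)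
      then show "b < a" using d h unfolding descending_def
        by (metis Suc_less_eq le_SucI)
    qed
  next
    assume d: "descending c"
    show "descending (lift c @ [n + 2, 2])"
      unfolding descending_def steps_lift_max_2[OF c l]
    proof (intro allI impI)
      let ?M = "map_prod (spread 1) Suc ` steps c"
      let ?E = "{(3, n + 2), (n + 2, 2)} \<union> ?M"
      fix i a j b assume h: "(i, a) \<in> ?E \<and> (j, b) \<in> ?E \<and> 3 \<le> i \<and> i < j"
      then have ij: "3 \<le> i" "i < j" by blast+
      \<comment> \<open>A lifted edge with source 3 would come from source 2, but 2 is the last
        entry of \<open>c\<close> and has no step. So sources from 3 on come from sources from 3
        on.\<close>
      have M: "3 \<le> x' \<and> (x', y') \<in> steps c" "x' \<le> n \<and> 2 \<le> y' \<and> y' \<le> n" "x = Suc x'" "y = Suc y'"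
        if "(x, y) \<in> ?M" "3 \<le> x" "x' = x - 1" "y' = y - 1" for x y x' y'
      proof -
        from that(1) obtain e where e: "(x, y) = map_prod (spread 1) Suc e" "e \<in> steps c" by (rule imageE)
        have b: "1 \<le> fst e" "fst e \<le> n" "2 \<le> snd e" "snd e \<le> n" using words_steps_bounds[OF c e(2)] by auto
        have xy: "x = spread 1 (fst e)" "y = Suc (snd e)" using e(1) by (cases e, simp)+
        have "fst e \<noteq> 1" using xy that(2) by (auto simp: spread_def)
        moreover have "fst e \<noteq> 2" using steps_not_last[of c "snd e"] c l e(2) by (cases e) (auto simp: words_def)
        ultimately have f: "3 \<le> fst e" using b by auto
        then have "x = Suc (fst e)" using xy by (simp add: spread_def)
        then show "3 \<le> x' \<and> (x', y') \<in> steps c" "x' \<le> n \<and> 2 \<le> y' \<and> y' \<le> n" "x = Suc x'" "y = Suc y'"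
          using f b e(2) xy that(3,4) by auto
      qed
      from h consider "(i, a) = (3, n + 2)" | "(i, a) = (n + 2, 2)" | "(i, a) \<in> ?M" by blast
      then show "b < a"
      proof cases
        case 1
        then have "(j, b) = (n + 2, 2) \<or> (j, b) \<in> ?M" using h by auto
        then show ?thesis
        proof
          assume "(j, b) = (n + 2, 2)"
          then show ?thesis using 1 n by auto
        next
          assume j: "(j, b) \<in> ?M"
          have "3 \<le> j" using ij by linarith
          from M(2,4)[OF j this refl refl] show ?thesis using 1 by auto
        qed
      next
        case 2
        then have j: "(j, b) \<in> ?M" using h by auto
        have "3 \<le> j" using ij by linarith
        from M(2,3)[OF j this refl refl] have "j \<le> n + 1" by auto
        then show ?thesis using 2 h by auto
      next
        case 3
        note Mi = M[OF 3 ij(1) refl refl]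
        have "(j, b) \<noteq> (3, n + 2)" using h by auto
        then consider "(j, b) = (n + 2, 2)" | "(j, b) \<in> ?M" using h by blast
        then show ?thesis
        proof cases
          case 1
          then show ?thesis using Mi h by auto
        next
          case 2
          have "3 \<le> j" using ij by linarith
          note Mj = M[OF 2 this refl refl]
          have "i - 1 < j - 1" using ij by linarith
          then have "b - 1 < a - 1" using Mi(1) Mj(1) d unfolding descending_def by blast
          then show ?thesis by linarith
        qed
      qed
    qed
  qed
  then show ?thesis using last c words_lift_max_2[OF c] by (auto simp: desc_words_def)
qed

text \<open>Removing the final \<open>r, 2\<close> reduces the length by two, hence the two base
  cases. Avoidance of 312 is carried along the same induction, which is why it need not be demanded
  in \<open>desc_words\<close>.\<close>

lemma desc_words_unique:
  "2 \<le> r \<Longrightarrow> \<exists>u. desc_words r = {u} \<and> av312 u"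
proof (induction r rule: less_induct)
  case (less r)
  consider "r = 2" | "r = 3" | "4 \<le> r" using less.prems by linarith
  then show ?case
  proof cases
    case 1
    then show ?thesis by (simp add: desc_words_2)
  next
    case 2
    have "av312 [1, 3, 2]" by (auto simp: av312_def subseq3_Cons subseq2_Cons simp del: subseq_Cons2_iff)
    then show ?thesis using 2 by (simp add: desc_words_3)
  next
    case 3
    define n where "n = r - 2"
    have n: "r = n + 2" "2 \<le> n" "n < r" using 3 unfolding n_def by linarith+
    obtain c where c: "desc_words n = {c}" "av312 c" using less.IH[OF n(3,2)] by blast
    have cw: "c \<in> desc_words n" "c \<in> words n" using c by (auto simp: desc_words_def)
    have "desc_words r = {lift c @ [n + 2, 2]}"
    proof (intro equalityI subsetI)
      fix u assume u: "u \<in> desc_words r"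
      then obtain d where d: "u = (d @ [3]) @ [n + 2, 2]" using desc_words_ends[OF u 3] n by auto
      have uw: "u \<in> words (n + 2)" using u n by (simp add: desc_words_def)
      have n1: "1 \<le> n" using n by simp
      obtain c' where c': "c' \<in> words n" "u = lift c' @ [n + 2, 2]" using words_ends_max_2E[OF uw n1 d] by blast
      then have "last (lift c') = 3" using d by (metis append_eq_append_conv last_snoc list.size(3,4))
      then have "c' \<in> desc_words n" using desc_words_lift_max_2[OF c'(1) n(2)] u c' n by simp
      then show "u \<in> {lift c @ [n + 2, 2]}" using c c' by simp
    next
      fix u assume "u \<in> {lift c @ [n + 2, 2]}"
      then show "u \<in> desc_words r" using desc_words_lift_max_2[OF cw(2) n(2)] cw n by simp
    qed
    moreover have "av312 (lift c @ [n + 2, 2])" using av312_lift_max_2[OF cw(2)] c by simp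
    ultimately show ?thesis by blast
  qed
qed

subsection \<open>The pattern 123\<close>

text \<open>The value 1 at source 2 completes every ascent at larger sources to a 123. Conversely,
  the last two sources of a 123 are at least 3, because the value 1 at source 2 cannot be its
  middle.\<close>

lemma good_123_last_2:
  assumes n: "2 \<le> n"
  shows "{c \<in> good (\<lambda>x y z. x < y \<and> y < z) n. last c = 2} = desc_words n"
proof (intro equalityI subsetI)
  fix c assume "c \<in> {c \<in> good (\<lambda>x y z. x < y \<and> y < z) n. last c = 2}"
  then have c: "c \<in> words n" "avoids (\<lambda>x y z. x < y \<and> y < z) (cyc c)" "last c = 2" by (auto simp: good_def)
  interpret word n c using c by unfold_locales
  have "descending c"
    unfolding descending_def
  proof (intro allI impI)
    fix i a j b assume h: "(i, a) \<in> steps c \<and> (j, b) \<in> steps c \<and> 3 \<le> i \<and> i < j"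
    then have s: "(i, a) \<in> cyc c" "(j, b) \<in> cyc c" "(2, 1) \<in> cyc c" using cyc_word[OF c(1)] c(3) by auto
    have "1 < a" using words_steps_bounds[OF c(1), of "(i, a)"] h by auto
    then have "\<not> a < b" using c(2) s h unfolding avoids_def by (metis Suc_1 Suc_le_eq numeral_3_eq_3 numeral_2_eq_2)
    moreover have "a \<noteq> b" using h nx_inj[of i j] unfolding steps_c by auto
    ultimately show "b < a" by simp
  qed
  then show "c \<in> desc_words n" using c by (simp add: desc_words_def)
next
  fix c assume d: "c \<in> desc_words n"
  then have c: "c \<in> words n" "descending c" "last c = 2" by (auto simp: desc_words_def)
  obtain u where "desc_words n = {u}" "av312 u" using desc_words_unique[OF n] by blast
  then have av: "av312 c" using d by simp
  have "avoids (\<lambda>x y z. x < y \<and> y < z) (cyc c)"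
    unfolding avoids_iff cyc_word[OF c(1)] c(3)
  proof (intro ballI impI notI)
    let ?E = "insert (2, 1) (steps c)"
    fix u v w assume uvw: "u \<in> ?E" "v \<in> ?E" "w \<in> ?E" "fst u < fst v" "fst v < fst w"
      and r: "snd u < snd v \<and> snd v < snd w"
    have b: "1 \<le> fst e \<and> 1 \<le> snd e" if "e \<in> ?E" for e using that words_steps_bounds[OF c(1), of e] by auto
    have "fst v \<noteq> 2"
    proof
      assume v2: "fst v = 2"
      have "v \<notin> steps c" using steps_not_last[of c "snd v"] c v2 by (cases v) (auto simp: words_def)
      then show False using uvw(2) r b[OF uvw(1)] by auto
    qed
    then have "3 \<le> fst v" using b[OF uvw(1)] uvw(4) by auto
    moreover from this have "v \<in> steps c" "w \<in> steps c" using uvw by auto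
    ultimately have "snd w < snd v" using c(2) uvw(5) unfolding descending_def by (metis prod.collapse)
    then show False using r by auto
  qed
  then show "c \<in> {c \<in> good (\<lambda>x y z. x < y \<and> y < z) n. last c = 2}" using c av by (simp add: good_def)
qed

text \<open>
  The admissible words ending with \<open>2, n, n - 1\<close>.
\<close>

definition exceptional :: "nat \<Rightarrow> nat list set" where
  "exceptional n = (if n = 4 then {[1, 2, 4, 3]} else if n = 5 then {[1, 3, 2, 5, 4]} else {})"

lemma exceptional_good: "exceptional n \<subseteq> good (\<lambda>x y z. x < y \<and> y < z) n"
proof -
  have "[1, 2, 4, 3] \<in> words 4" "[1, 3, 2, 5, 4] \<in> words 5" by (auto simp: words_def)
  moreover have "av312 [1, 2, 4, 3]" "av312 [1, 3, 2, 5, 4]"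
    by (auto simp: av312_def subseq3_Cons subseq2_Cons simp del: subseq_Cons2_iff)
  moreover have "avoids (\<lambda>x y z. x < y \<and> y < z) (cyc [1, 2, 4, 3])" "avoids (\<lambda>x y z. x < y \<and> y < z) (cyc [1, 3, 2, 5, 4])"
    by (simp_all add: avoids_iff cyc_def)
  ultimately show ?thesis by (simp add: exceptional_def good_def)
qed

text \<open>Three families, told apart by the last entry: 2 for a single word, \<open>n + 2\<close>
  for a copy of the words of length \<open>n\<close>, and neither for the sporadic word that occurs
  in lengths 4 and 5 only.\<close>

lemma card_good_123_rec:
  "card (good (\<lambda>x y z. x < y \<and> y < z) (n + 2)) =
    card (good (\<lambda>x y z. x < y \<and> y < z) n) + (if n = 2 \<or> n = 3 then 2 else 1)" if n: "2 \<le> n"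
proof -
  let ?R = "\<lambda>x y z :: nat. x < y \<and> y < z"
  let ?D = "desc_words (n + 2)" and ?L = "(\<lambda>c. lift c @ [2, n + 2]) ` good ?R n" and ?X = "exceptional (n + 2)"
  have D: "?D = {c \<in> good ?R (n + 2). last c = 2}" using good_123_last_2[of "n + 2"] by simp
  have lift: "lift c @ [2, n + 2] \<in> good ?R (n + 2) \<longleftrightarrow> c \<in> good ?R n" if "c \<in> words n" for c
    using that by (rule good_lift_2_max) auto
  have "good ?R (n + 2) = ?D \<union> (?L \<union> ?X)"
  proof (intro equalityI subsetI)
    fix w assume w: "w \<in> good ?R (n + 2)"
    then have ww: "w \<in> words (n + 2)" by (simp add: good_def)
    show "w \<in> ?D \<union> (?L \<union> ?X)"
    proof (cases "last w = 2")
      case True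
      then show ?thesis using w D by blast
    next
      case False
      have "4 \<le> n + 2" using n by simp
      from structure_123[OF w this False] show ?thesis
      proof (elim disjE exE)
        fix d assume "w = d @ [2, n + 2]"
        then obtain c where c: "c \<in> words n" "w = lift c @ [2, n + 2]" using words_ends_2_maxE[OF ww] n by auto
        then show ?thesis using lift w by blast
      next
        assume "w = [1, 2, 4, 3]"
        moreover from this have "n + 2 = 4" using words_length[OF ww] by simp
        ultimately show ?thesis by (simp add: exceptional_def)
      next
        assume "w = [1, 3, 2, 5, 4]"
        moreover from this have "n + 2 = 5" using words_length[OF ww] by simp
        ultimately show ?thesis by (simp add: exceptional_def)
      qed
    qed
  next
    fix w assume "w \<in> ?D \<union> (?L \<union> ?X)"
    moreover have "c \<in> words n" if "c \<in> good ?R n" for c using that by (simp add: good_def)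
    ultimately show "w \<in> good ?R (n + 2)" using D lift exceptional_good by blast
  qed
  moreover have "card (?D \<union> (?L \<union> ?X)) = card ?D + (card ?L + card ?X)"
  proof -
    have last_L: "last w = n + 2" if "w \<in> ?L" for w using that by auto
    have last_X: "last w \<noteq> 2" "last w \<noteq> n + 2" if "w \<in> ?X" for w
      using that by (auto simp: exceptional_def split: if_splits)
    have "last w = 2" if "w \<in> ?D" for w using that by (simp add: desc_words_def)
    moreover have "last w \<noteq> 2" if "w \<in> ?L \<union> ?X" for w
    proof (cases "w \<in> ?L")
      case True
      then show ?thesis using last_L[OF True] n by linarith
    next
      case False
      then show ?thesis using last_X(1) that by blast
    qed
    ultimately have "?D \<inter> (?L \<union> ?X) = {}" by blast
    moreover have "?L \<inter> ?X = {}" using last_L last_X(2) by blast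
    moreover have "finite ?D" unfolding D using finite_good by simp
    moreover have "finite ?L" "finite ?X" using finite_good by (simp_all add: exceptional_def)
    ultimately show ?thesis by (simp add: card_Un_disjoint)
  qed
  moreover have "card ?L = card (good ?R n)"
    by (rule card_image) (use inj_on_lift[of n] in \<open>auto simp: inj_on_def good_def\<close>)
  moreover have "card ?D = 1"
  proof -
    obtain u where "desc_words (n + 2) = {u}" using desc_words_unique[of "n + 2"] by auto
    then show ?thesis by simp
  qed
  moreover have "card ?X = (if n = 2 \<or> n = 3 then 1 else 0)" by (auto simp: exceptional_def)
  ultimately show ?thesis by simp
qed

text \<open>In lengths 2 and 3 the counts are 1 and 2, one less than the formula would give; the
  sporadic words in lengths 4 and 5 make up for this.\<close>

lemma card_good_123:
  "4 \<le> n \<Longrightarrow> card (good (\<lambda>x y z. x < y \<and> y < z) n) = (n + 1) div 2 + 1"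
proof (induction n rule: less_induct)
  case (less n)
  let ?a = "\<lambda>n. card (good (\<lambda>x y z :: nat. x < y \<and> y < z) n)"
  have a2: "?a 2 = 1" unfolding good_2 by simp
  have "good (\<lambda>x y z. x < y \<and> y < z) 3 = {[1, 2, 3], [1, 3, 2]}"
    unfolding good_def words_3
    by (auto simp: avoids_iff cyc_def av312_def subseq3_Cons subseq2_Cons simp del: subseq_Cons2_iff)
  then have a3: "?a 3 = 2" by simp
  define k where "k = n - 2"
  have k: "n = k + 2" "2 \<le> k" "k < n" using less.prems unfolding k_def by linarith+
  note rec = card_good_123_rec[OF k(2)]
  consider "k = 2" | "k = 3" | "4 \<le> k" using k by linarith
  then show ?case
  proof cases
    case 1
    then show ?thesis using rec a2 k by simp
  next
    case 2
    then show ?thesis using rec a3 k by simp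
  next
    case 3
    then show ?thesis using rec less.IH[OF k(3) 3] k by simp
  qed
qed

subsection \<open>The pattern 312\<close>

text \<open>The block has sources and targets up to \<open>k\<close>, its last entry adds the edge
  \<open>(2, k + 1)\<close>, and the edges in \<open>Q\<close> have larger sources, with targets 1
  or beyond \<open>k + 1\<close>. A 312 that opens in \<open>Q\<close> stays in \<open>Q\<close>;
  all others are excluded by the decrease inside the block.\<close>

lemma good_glue_desc_words:
  assumes u: "u \<in> desc_words k" "av312 u" and c: "c \<in> words n" and k: "3 \<le> k"
  shows "glue u c \<in> good (\<lambda>x y z. y < z \<and> z < x) (k + n) \<longleftrightarrow> c \<in> good (\<lambda>x y z. y < z \<and> z < x) n"
proof -
  let ?R = "\<lambda>x y z :: nat. y < z \<and> z < x"
  define Q where "Q = map_prod (\<lambda>x. x + k) (spread k) ` cyc c"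
  have uw: "u \<in> words k" "descending u" "last u = 2" using u by (auto simp: desc_words_def)
  have S: "1 \<le> fst e \<and> fst e \<le> k \<and> fst e \<noteq> 2 \<and> 2 \<le> snd e \<and> snd e \<le> k" if "e \<in> steps u" for e
    using words_steps_bounds[OF uw(1) that] steps_not_last[of u "snd e"] uw that
    by (cases e) (auto simp: words_def)
  have M: "k < fst e" "snd e = 1 \<or> k + 1 < snd e" if "e \<in> Q" for e
  proof -
    from that[unfolded Q_def] obtain f where f: "e = map_prod (\<lambda>x. x + k) (spread k) f" "f \<in> cyc c" by (rule imageE)
    have "1 \<le> fst f" "1 \<le> snd f" using cyc_word_bounds[OF c f(2)] by auto
    then show "k < fst e" "snd e = 1 \<or> k + 1 < snd e" using f(1) by (auto simp: spread_def)
  qed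
  have cyc: "cyc (glue u c) = steps u \<union> insert (2, k + 1) Q"
    using cyc_glue[OF uw(1) c] uw(3) by (simp add: Q_def)
  have "avoids ?R (steps u \<union> insert (2, k + 1) Q) \<longleftrightarrow> avoids ?R Q"
  proof
    assume E: "avoids ?R Q"
    show "avoids ?R (steps u \<union> insert (2, k + 1) Q)"
      unfolding avoids_iff
    proof (intro ballI impI notI)
      let ?E = "steps u \<union> insert (2, k + 1) Q"
      fix e f g assume efg: "e \<in> ?E" "f \<in> ?E" "g \<in> ?E" "fst e < fst f" "fst f < fst g"
        and r: "snd f < snd g \<and> snd g < snd e"
      have pos: "1 \<le> snd x \<and> 1 \<le> fst x" if "x \<in> ?E" for x
      proof (cases "x \<in> Q")
        case True
        show ?thesis using M[OF True] by linarith
      next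
        case False
        then have "x \<in> steps u \<or> x = (2, k + 1)" using that by blast
        then show ?thesis using S[of x] by auto
      qed
      have inM: "x \<in> Q" if "x \<in> ?E" "k < fst x" for x
      proof -
        have "x \<notin> steps u" using S[of x] that by auto
        moreover have "x \<noteq> (2, k + 1)" using that k by auto
        ultimately show ?thesis using that by blast
      qed
      show False
      proof (cases "k < fst e")
        case True
        then have "k < fst f" "k < fst g" using efg by linarith+
        then have m: "e \<in> Q" "f \<in> Q" "g \<in> Q" using inM efg(1-3) True by blast+
        show False using E[unfolded avoids_iff, rule_format, OF m efg(4,5)] r by simp
      next
        \<comment> \<open>The opening value is at most \<open>k + 1\<close>, so the closing value
          lies between 2 and \<open>k\<close> and belongs to the block. The middle edge has a
          smaller source and belongs to it too; both sources are at least 3, where an ascent is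
          impossible.\<close>
        case False
        then have "e \<notin> Q" using M(1)[of e] by blast
        then have "snd e \<le> k + 1" using efg(1) S[of e] by auto
        then have g: "snd g \<le> k" "1 < snd g" using r pos[OF efg(2)] by linarith+
        have small: "x \<in> steps u" if "x \<in> ?E" "snd x \<le> k" "snd x \<noteq> 1" for x
        proof -
          have "x \<noteq> (2, k + 1)" using that by auto
          moreover have "x \<notin> Q" using M(2)[of x] that by auto
          ultimately show ?thesis using that by blast
        qed
        have gs: "g \<in> steps u" using small[OF efg(3)] g by simp
        then have "\<not> k < fst f" using S[OF gs] efg(5) by auto
        then have "f \<notin> Q" using M(1)[of f] by blast
        moreover have "f \<noteq> (2, k + 1)" using g r by auto
        ultimately have fs: "f \<in> steps u" using efg(2) by blast
        have "2 \<le> fst f" "fst f \<noteq> 2" using pos[OF efg(1)] efg(4) S[OF fs] by auto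
        then have "3 \<le> fst f" by linarith
        then have "snd g < snd f" using uw(2) fs gs efg(5) unfolding descending_def by (metis prod.collapse)
        then show False using r by simp
      qed
    qed
  qed (auto intro: avoids_subset)
  also have "avoids ?R Q \<longleftrightarrow> avoids ?R (cyc c)"
    unfolding Q_def by (rule avoids_map_prod) (auto simp: strict_mono_def)
  finally have "avoids ?R (cyc (glue u c)) \<longleftrightarrow> avoids ?R (cyc c)" unfolding cyc .
  then show ?thesis using words_glue[OF uw(1) c] av312_glue[OF uw(1) c] u c by (simp add: good_def)
qed

lemma glue_nth_last: "length u = k \<Longrightarrow> u \<noteq> [] \<Longrightarrow> glue u c ! (k - 1) = last u"
  by (auto simp: glue_def nth_append last_conv_nth)

text \<open>The words are sorted by the position of 2: it is second after a leading
  \<open>1, 2\<close>, and it is the last entry of a block of length \<open>k \<ge> 3\<close>. As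
  each length admits one block only, every family is a copy of the words that remain behind
  it.\<close>

lemma card_good_312_rec:
  assumes n: "3 \<le> n"
  shows "card (good (\<lambda>x y z. y < z \<and> z < x) n) =
    card (good (\<lambda>x y z. y < z \<and> z < x) (n - 1)) + (\<Sum>k = 3..n - 1. card (good (\<lambda>x y z. y < z \<and> z < x) (n - k)))"
proof -
  let ?R = "\<lambda>x y z :: nat. y < z \<and> z < x"
  obtain E where E: "desc_words k = {E k}" "av312 (E k)" if "2 \<le> k" for k
    using desc_words_unique by metis
  define G where "G k = glue (E k) ` good ?R (n - k)" for k
  define G1 where "G1 = glue [Suc 0] ` good ?R (n - 1)"
  have words: "c \<in> good ?R m \<Longrightarrow> c \<in> words m" for c m by (simp add: good_def)
  have Ew: "E k \<in> desc_words k" "E k \<in> words k" "last (E k) = 2" "length (E k) = k" "E k \<noteq> []" if "2 \<le> k" for k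
  proof -
    show m: "E k \<in> desc_words k" using E(1)[OF that] by simp
    show w: "E k \<in> words k" "last (E k) = 2" using m unfolding desc_words_def by simp_all
    show "length (E k) = k" by (rule words_length[OF w(1)])
    show "E k \<noteq> []" using w(1) by (simp add: words_def)
  qed
  have glue1: "glue [Suc 0] c \<in> good ?R n \<longleftrightarrow> c \<in> good ?R (n - 1)" if "c \<in> words (n - 1)" for c
  proof -
    have "glue [Suc 0] c \<in> good ?R (Suc (n - 1)) \<longleftrightarrow> c \<in> good ?R (n - 1)"
      using that by (rule good_glue_1) auto
    then show ?thesis using n by simp
  qed
  have gluek: "glue (E k) c \<in> good ?R n \<longleftrightarrow> c \<in> good ?R (n - k)" if "c \<in> words (n - k)" "k \<in> {3..n - 1}" for c k
    using good_glue_desc_words[OF Ew(1) E(2) that(1), of k] that(2) n by auto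
  have "good ?R n = G1 \<union> (\<Union>k\<in>{3..n - 1}. G k)"
  proof (intro equalityI subsetI)
    fix w assume w: "w \<in> good ?R n"
    have ww: "w \<in> words n" using words[OF w] .
    show "w \<in> G1 \<union> (\<Union>k\<in>{3..n - 1}. G k)"
    proof (cases "w ! 1 = 2")
      case True
      have "w \<in> words (Suc (n - 1))" "1 \<le> n - 1" using ww n by auto
      then obtain c where "c \<in> words (n - 1)" "w = glue [Suc 0] c" using words_nth_1_eq_2E True by blast
      then show ?thesis using glue1 w unfolding G1_def by blast
    next
      case False
      obtain u v where uv: "w = u @ v" "3 \<le> length u" "v \<noteq> []" "last u = 2" "set u = {1..length u}"
        "hd v = length u + 1" "descending u"
        using structure_312[OF w n False] by blast
      have "u @ v \<in> words n" "u \<noteq> []" using ww uv by auto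
      then obtain c where c: "u \<in> words (length u)" "c \<in> words (n - length u)" "u @ v = glue u c" "length u < n"
        using words_glueE[of u v n] uv by blast
      define k where "k = length u"
      have k: "k \<in> {3..n - 1}" "2 \<le> k" using c(4) uv(2) k_def by auto
      have "u \<in> desc_words k" using c(1) uv k_def by (simp add: desc_words_def)
      then have "u = E k" using E(1)[OF k(2)] by simp
      then have "w = glue (E k) c" using uv c by simp
      then have "w \<in> G k" using gluek[of c k] w c(2) k k_def unfolding G_def by blast
      then show ?thesis using k by blast
    qed
  next
    fix w assume "w \<in> G1 \<union> (\<Union>k\<in>{3..n - 1}. G k)"
    then consider "w \<in> G1" | k where "k \<in> {3..n - 1}" "w \<in> G k" by blast
    then show "w \<in> good ?R n"
    proof cases
      case 1
      then show ?thesis using glue1 words unfolding G1_def by blast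
    next
      case 2
      then show ?thesis using gluek words unfolding G_def by blast
    qed
  qed
  moreover have "card (G1 \<union> (\<Union>k\<in>{3..n - 1}. G k)) = card G1 + card (\<Union>k\<in>{3..n - 1}. G k)"
  proof (rule card_Un_disjoint)
    show "finite G1" "finite (\<Union>k\<in>{3..n - 1}. G k)" using finite_good by (auto simp: G1_def G_def)
    have "w \<notin> G1" if "w \<in> G k" "k \<in> {3..n - 1}" for w k
    proof
      assume "w \<in> G1"
      then obtain c where c: "c \<in> words (n - 1)" "w = glue [Suc 0] c" "glue [Suc 0] c \<in> good ?R n"
        using words glue1 unfolding G1_def by blast
      have k: "2 \<le> k" "3 \<le> k" "k \<le> n - 1" using that by auto
      obtain d where d: "w = glue (E k) d" using \<open>w \<in> G k\<close> unfolding G_def by blast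
      have "w ! (k - 1) = 2" using glue_nth_last[OF Ew(4,5)[OF k(1)]] Ew(3)[OF k(1)] d by simp
      moreover have "w ! 1 = 2" using glue_1_nth_1 c by blast
      moreover have "distinct w" "length w = n" using words[OF c(3)] words_length c by (auto simp: words_def)
      moreover have "1 < n" "k - 1 < n" "k - 1 \<noteq> 1" using k n by linarith+
      ultimately show False using nth_eq_iff_index_eq by metis
    qed
    then show "G1 \<inter> (\<Union>k\<in>{3..n - 1}. G k) = {}" by blast
  qed
  moreover have "card (\<Union>k\<in>{3..n - 1}. G k) = (\<Sum>k = 3..n - 1. card (G k))"
  proof (rule card_UN_disjoint)
    show "\<forall>k\<in>{3..n - 1}. finite (G k)" using finite_good by (auto simp: G_def)
    have "j = k" if "w \<in> G k" "w \<in> G j" "k \<in> {3..n - 1}" "j \<in> {3..n - 1}" for w k j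
    proof -
      have kj: "2 \<le> k" "2 \<le> j" "k - 1 < n" "j - 1 < n" using that by auto
      obtain d d' where d: "w = glue (E k) d" "w = glue (E j) d'" "d \<in> good ?R (n - k)"
        using \<open>w \<in> G k\<close> \<open>w \<in> G j\<close> unfolding G_def by blast
      have "w ! (k - 1) = 2" "w ! (j - 1) = 2"
        using glue_nth_last[OF Ew(4,5)[OF kj(1)]] Ew(3)[OF kj(1)] glue_nth_last[OF Ew(4,5)[OF kj(2)]] Ew(3)[OF kj(2)] d
        by metis+
      moreover have "w \<in> words n" using gluek[of d k] d words that(3) by blast
      then have "distinct w" "length w = n" using words_length by (auto simp: words_def)
      ultimately have "k - 1 = j - 1" using kj nth_eq_iff_index_eq by metis
      then show ?thesis using kj by linarith
    qed
    then show "\<forall>i\<in>{3..n - 1}. \<forall>j\<in>{3..n - 1}. i \<noteq> j \<longrightarrow> G i \<inter> G j = {}" by blast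
  qed simp
  moreover have "card G1 = card (good ?R (n - 1))"
    unfolding G1_def by (rule card_image) (metis inj_glue inj_on_subset subset_UNIV)
  moreover have "card (G k) = card (good ?R (n - k))" for k
    unfolding G_def by (rule card_image) (metis inj_glue inj_on_subset subset_UNIV)
  ultimately show ?thesis by simp
qed

section \<open>The binomial sum and its recurrence\<close>

definition binomial_sum :: "nat \<Rightarrow> nat" where
  "binomial_sum N = (\<Sum>k\<le>N. (N - k) choose (2 * k))"

text \<open>Pascal's rule leads from even to odd lower indices and back, so this companion is needed
  to close the recurrence.\<close>

definition binomial_sum_odd :: "nat \<Rightarrow> nat" where
  "binomial_sum_odd N = (\<Sum>k\<le>N. (N - k) choose Suc (2 * k))"

lemma binomial_sum_Suc: "binomial_sum (Suc (Suc N)) = binomial_sum (Suc N) + binomial_sum_odd N"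
proof -
  \<comment> \<open>The top term vanishes and the term for \<open>k = 0\<close> is 1; Pascal's rule
    then applies to all the others.\<close>
  have "binomial_sum (Suc (Suc N)) = 1 + (\<Sum>k\<le>N. (Suc N - k) choose (2 * Suc k))"
    unfolding binomial_sum_def by (subst sum.atMost_Suc, subst sum.atMost_Suc_shift) simp
  also have "(\<Sum>k\<le>N. (Suc N - k) choose (2 * Suc k)) =
      (\<Sum>k\<le>N. ((N - k) choose (2 * Suc k)) + ((N - k) choose Suc (2 * k)))"
    by (rule sum.cong) (auto simp: Suc_diff_le)
  also have "\<dots> = (\<Sum>k\<le>N. (N - k) choose (2 * Suc k)) + binomial_sum_odd N"
    by (simp add: sum.distrib binomial_sum_odd_def)
  finally have "binomial_sum (Suc (Suc N)) =
      1 + (\<Sum>k\<le>N. (N - k) choose (2 * Suc k)) + binomial_sum_odd N" by simp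
  also have "1 + (\<Sum>k\<le>N. (N - k) choose (2 * Suc k)) = binomial_sum (Suc N)"
    unfolding binomial_sum_def by (subst sum.atMost_Suc_shift) simp
  finally show ?thesis .
qed

text \<open>Pascal's rule at odd lower indices shows that increasing \<open>N\<close> by one adds
  exactly \<open>binomial_sum N\<close>.\<close>

lemma binomial_sum_odd_eq: "binomial_sum_odd N = sum binomial_sum {..<N}"
proof (induction N)
  case 0
  show ?case by (simp add: binomial_sum_odd_def)
next
  case (Suc N)
  have "binomial_sum_odd (Suc N) = (\<Sum>k\<le>N. (Suc N - k) choose Suc (2 * k))"
    unfolding binomial_sum_odd_def by simp
  also have "\<dots> = (\<Sum>k\<le>N. ((N - k) choose (2 * k)) + ((N - k) choose Suc (2 * k)))"
    by (rule sum.cong) (auto simp: Suc_diff_le)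
  finally show ?case using Suc by (simp add: sum.distrib binomial_sum_odd_def binomial_sum_def)
qed

lemma card_good_312: "1 \<le> n \<Longrightarrow> card (good (\<lambda>x y z. y < z \<and> z < x) n) = binomial_sum (n - 1)"
proof (induction n rule: less_induct)
  case (less n)
  let ?a = "\<lambda>n. card (good (\<lambda>x y z :: nat. y < z \<and> z < x) n)"
  consider "n = 1" | "n = 2" | "3 \<le> n" using less.prems by linarith
  then show ?case
  proof cases
    case 1
    show ?thesis unfolding 1 good_1 by (simp add: binomial_sum_def)
  next
    case 2
    show ?thesis unfolding 2 good_2 by (simp add: binomial_sum_def)
  next
    case 3
    define N where "N = n - 3"
    have N: "n = N + 3" "n - 1 = Suc (Suc N)" "n - 1 - 1 = Suc N" using 3 unfolding N_def by linarith+
    have "?a (n - 1) = binomial_sum (Suc N)" using less.IH[of "n - 1"] 3 N by simp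
    \<comment> \<open>The count for length \<open>n - k\<close> is the binomial sum at
      \<open>n - 1 - k\<close>, and this index runs from \<open>n - 4 = N - 1\<close> down to
      0.\<close>
    moreover have "(\<Sum>k = 3..n - 1. ?a (n - k)) = sum binomial_sum {..<N}"
    proof (rule sum.reindex_bij_witness[of _ "\<lambda>j. n - 1 - j" "\<lambda>k. n - 1 - k"])
      fix k assume "k \<in> {3..n - 1}"
      then have k: "n - k < n" "1 \<le> n - k" "n - k - 1 = n - 1 - k" by auto
      show "binomial_sum (n - 1 - k) = ?a (n - k)" using less.IH[OF k(1,2)] k(3) by simp
    qed (use N in auto)
    ultimately show ?thesis
      using card_good_312_rec[OF 3] binomial_sum_Suc[of N] binomial_sum_odd_eq[of N] N by simp
  qed
qed

text \<open>For \<open>k > N div 3\<close> the lower index \<open>2 * k\<close> exceeds the upper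
  index \<open>N - k\<close>, so the sum may be cut anywhere from there on.\<close>

lemma binomial_sum_restrict:
  assumes "N div 3 \<le> M" "M \<le> N"
  shows "binomial_sum N = (\<Sum>k = 0..M. (N - k) choose (2 * k))"
  unfolding binomial_sum_def
proof (rule sum.mono_neutral_right)
  show "\<forall>k\<in>{..N} - {0..M}. (N - k) choose (2 * k) = 0"
  proof
    fix k assume "k \<in> {..N} - {0..M}"
    then have "N div 3 < k" using assms by auto
    then have "N - k < 2 * k" by linarith
    then show "(N - k) choose (2 * k) = 0" by (rule binomial_eq_0)
  qed
qed (use assms in auto)

theorem theorem5p1:
  fixes n :: nat
  assumes "n \<ge> 5"
  shows "num_cyclic_avoiders n [1,2,3] [3,1,2] = nat \<lceil>real n / 2\<rceil> + 1 \<and>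
         num_cyclic_avoiders n [1,3,2] [3,1,2] = n - 1 \<and>
         num_cyclic_avoiders n [2,1,3] [3,1,2] = fib n \<and>
         num_cyclic_avoiders n [2,3,1] [3,1,2] = 1 \<and>
         num_cyclic_avoiders n [3,1,2] [3,1,2] =
           (\<Sum>k = 0..nat \<lfloor>(real n - 1) / 3\<rfloor>. (n - 1 - k) choose (2 * k)) \<and>
         num_cyclic_avoiders n [3,2,1] [3,1,2] = 2 ^ (n - 2)"
proof -
  have n: "1 \<le> n" "2 \<le> n" "4 \<le> n" using assms by auto
  note count = num_cyclic_avoiders_eq_card_good[OF n(1)]
  \<comment> \<open>Here and below, \<open>R\<close> spells out the relative order of \<sigma>; what
    remains to be checked is that it agrees with the six comparisons of its letters.\<close>
  have "num_cyclic_avoiders n [1,2,3] [3,1,2] = card (good (\<lambda>x y z. x < y \<and> y < z) n)"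
    by (rule count) auto
  also have "\<dots> = nat \<lceil>real n / 2\<rceil> + 1"
  proof -
    have "nat \<lceil>real n / 2\<rceil> = (n + 1) div 2" by linarith
    then show ?thesis unfolding card_good_123[OF n(3)] by simp
  qed
  finally have case_123: "num_cyclic_avoiders n [1,2,3] [3,1,2] = nat \<lceil>real n / 2\<rceil> + 1" .
  have "num_cyclic_avoiders n [1,3,2] [3,1,2] = card (good (\<lambda>x y z. x < z \<and> z < y) n)"
    by (rule count) auto
  then have case_132: "num_cyclic_avoiders n [1,3,2] [3,1,2] = n - 1"
    unfolding card_good_132[OF n(2)] .
  have "num_cyclic_avoiders n [2,1,3] [3,1,2] = card (good (\<lambda>x y z. y < x \<and> x < z) n)"
    by (rule count) auto
  then have case_213: "num_cyclic_avoiders n [2,1,3] [3,1,2] = fib n"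
    unfolding card_good_213[OF n(2)] .
  have "num_cyclic_avoiders n [2,3,1] [3,1,2] = card (good (\<lambda>x y z. z < x \<and> x < y) n)"
    by (rule count) auto
  then have case_231: "num_cyclic_avoiders n [2,3,1] [3,1,2] = 1"
    unfolding card_good_231[OF n(1)] .
  have "num_cyclic_avoiders n [3,1,2] [3,1,2] = card (good (\<lambda>x y z. y < z \<and> z < x) n)"
    by (rule count) auto
  also have "\<dots> = (\<Sum>k = 0..nat \<lfloor>(real n - 1) / 3\<rfloor>. (n - 1 - k) choose (2 * k))"
    unfolding card_good_312[OF n(1)]
  proof (rule binomial_sum_restrict)
    have "(real n - 1) / 3 = real (n - 1) / real 3" using n(1) by (simp add: of_nat_diff)
    then have "nat \<lfloor>(real n - 1) / 3\<rfloor> = (n - 1) div 3"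
      by (simp only: floor_divide_of_nat_eq nat_int)
    then show "(n - 1) div 3 \<le> nat \<lfloor>(real n - 1) / 3\<rfloor>" "nat \<lfloor>(real n - 1) / 3\<rfloor> \<le> n - 1" by simp_all
  qed
  finally have case_312: "num_cyclic_avoiders n [3,1,2] [3,1,2] =
    (\<Sum>k = 0..nat \<lfloor>(real n - 1) / 3\<rfloor>. (n - 1 - k) choose (2 * k))" .
  have "num_cyclic_avoiders n [3,2,1] [3,1,2] = card (good (\<lambda>x y z. z < y \<and> y < x) n)"
    by (rule count) auto
  then have case_321: "num_cyclic_avoiders n [3,2,1] [3,1,2] = 2 ^ (n - 2)"
    unfolding card_good_321[OF n(2)] .
  show ?thesis
    using case_123 case_132 case_213 case_231 case_312 case_321 by (intro conjI)
qed

end
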